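(* Assume that $(A_1)$–$(A_3)$ hold and that there exists a positive constant $C$ such that $|g_1(x,y)|\le C$ for all $(x,y)\in\mathbb R^{n_1}\times\mathbb R^{n_2}$. Then the slow manifold $\mathcal M^\varepsilon(\omega)=\{(x_0,\hat h^\varepsilon(\omega,x_0)):x_0\in\mathbb R^{n_1}\}$ converges to the critical manifold $\mathcal M^0(\omega)=\{(x_0,h^0(\omega,x_0)):x_0\in\mathbb R^{n_1}\}$ in distribution as $\varepsilon\to0$. In other words, for $x_0\in\mathbb R^{n_1}$, $\omega\in\Omega$, $$\hat h^\varepsilon(\omega,x_0)\stackrel{d}{=}h^0(\omega,x_0)+\mathcal O(\varepsilon)\quad\text{in }\mathbb R^{n_2}\text{ as }\varepsilon\to0 .$$
   Context: Setting. $|\cdot|$ is the Euclidean norm, $n=n_1+n_2$, $\sigma>0$, $1<\alpha<2$. $S$ is an $n_1\times n_1$ matrix all of whose eigenvalues have non-negative real part, $F$ is an $n_2\times n_2$ matrix all of whose eigenvalues have negative real part, and $g_i:\mathbb R^{n_1}\times\mathbb R^{n_2}\to\mathbb R^{n_i}$ ($i=1,2$) are Lipschitz continuous with $g_i(0,0)=0$. Hypotheses. $(A_1)$: there are constants $\gamma_s>0$ and $\gamma_f<0$ such that $|e^{St}x|\le e^{\gamma_st}|x|$ for $t\le0$, $x\in\mathbb R^{n_1}$, and $|e^{Ft}y|\le e^{\gamma_ft}|y|$ for $t\ge0$, $y\in\mathbb R^{n_2}$. $(A_2)$: there is $K>0$ with $|g_i(x_1,y_1)-g_i(x_2,y_2)|\le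 K(|x_1-x_2|+|y_1-y_2|)$ for all $(x_j,y_j)\in\mathbb R^n$, $i=1,2$. $(A_3)$: $K<-\gamma_f$. A number $\gamma>0$ with $K<-(\gamma+\gamma_f)$ is fixed, and $\beta=-\gamma/\varepsilon$. Noise. $\Omega=\mathcal D_0(\mathbb R,\mathbb R^{n_2})$ is the space of càdlàg functions $\omega:\mathbb R\to\mathbb R^{n_2}$ with $\omega(0)=0$, with the Borel $\sigma$-algebra of the Skorokhod topology; $\mathbb P$ is the law making $L_t^\alpha(\omega)=\omega(t)$ a two-sided $\alpha$-stable Lévy process, which is self-similar: $L^\alpha_{ct}\stackrel d=c^{1/\alpha}L^\alpha_t$ (as processes in $t$) for $c>0$; $\theta_t\omega=\omega(\cdot+t)-\omega(t)$ is the shift flow, which preserves $\mathbb P$. On a $\theta$-invariant set of full measure (again denoted $\Omega$) put $\eta^{\frac1\varepsilon}(\omega)=\varepsilon^{-\frac1\alpha}\int_{-\infty}^0e^{-Fs/\varepsilon}dL_s^\alpha(\omega)$ and $\xi(\omega)=\int_{-\infty}^0e^{-Fs}dL_s^\alpha(\omega)$; $t\mapsto\eta^{\frac1\varepsilon}(\theta_t\omega)$ and $t\mapsto\xi(\theta_t\omega)$ are càdlàg with sublinear growth. Slow manifold $\mathcal M^\varepsilon$. For $\hat\beta\in\mathbb R$, $C_{\hat\beta}^-$ is the Banach space of continuous $(\phi^s,\phi^f):(-\infty,0]\to\mathbb R^{n_1}\times\mathbb R^{n_2}$ with finite norm $\sup_{t\le0}|e^{-\hat\beta t}\phi^s_t|+\sup_{t\le0}|e^{-\hat\beta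 t}\phi^f_t|$, and $C_{\hat\beta}^{f,-}$ is the space of continuous $\phi^f:(-\infty,0]\to\mathbb R^{n_2}$ with $\sup_{t\le0}|e^{-\hat\beta t}\phi^f_t|<\infty$. For sufficiently small $\varepsilon>0$ and each $x_0\in\mathbb R^{n_1}$ there is a unique $(\hat x^\varepsilon,\hat y^\varepsilon)\in C_\beta^-$ satisfying, for $t\le0$, $$\hat x^\varepsilon(t)=e^{St}x_0+\int_0^te^{S(t-s)}g_1(\hat x^\varepsilon(s),\hat y^\varepsilon(s)+\sigma\eta^{\frac1\varepsilon}(\theta_s\omega))ds,\quad \hat y^\varepsilon(t)=\tfrac1\varepsilon\int_{-\infty}^te^{F(t-s)/\varepsilon}g_2(\hat x^\varepsilon(s),\hat y^\varepsilon(s)+\sigma\eta^{\frac1\varepsilon}(\theta_s\omega))ds,$$ and $\hat h^\varepsilon(\omega,x_0)=\hat y^\varepsilon(0)$. $\mathcal M^\varepsilon$ is the slow manifold of the system $d\hat x^\varepsilon=S\hat x^\varepsilon dt+g_1(\hat x^\varepsilon,\hat y^\varepsilon+\sigma\eta^{\frac1\varepsilon}(\theta_t\omega))dt$, $d\hat y^\varepsilon=\frac1\varepsilon F\hat y^\varepsilon dt+\frac1\varepsilon g_2(\hat x^\varepsilon,\hat y^\varepsilon+\sigma\eta^{\frac1\varepsilon}(\theta_t\omega))dt$. Critical manifold $\mathcal M^0$. $h^0(\omega,x_0)=\int_{-\infty}^0e^{-Fs}g_2(x_0,y^0(s)+\sigma\xi(\theta_s\omega))ds$, where $y^0$ is the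 unique solution in $C_{-\gamma}^{f,-}$ of $y^0(t)=\int_{-\infty}^te^{F(t-s)}g_2(x_0,y^0(s)+\sigma\xi(\theta_s\omega))ds$, $t\le0$. Notation. $\stackrel d=$ is equality in distribution. The displayed statement means: for each $x_0$ and all sufficiently small $\varepsilon>0$ there is an $\mathbb R^{n_2}$-valued random variable $r^\varepsilon(\omega,x_0)$, with $r^\varepsilon(\omega,x_0)=\mathcal O(\varepsilon)$ as $\varepsilon\to0$ for $\omega\in\Omega$, such that $\hat h^\varepsilon(\cdot,x_0)$ and $h^0(\cdot,x_0)+r^\varepsilon(\cdot,x_0)$ have the same distribution; convergence of $\mathcal M^\varepsilon$ to $\mathcal M^0$ in distribution is understood in this sense. *)

theory Defs
  imports "HOL-Probability.Probability" "HOL-Library.Landau_Symbols"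
begin

definition complex_eigenvalue :: "real^'n^'n \<Rightarrow> complex \<Rightarrow> bool" where
  "complex_eigenvalue A z \<longleftrightarrow>
     (\<exists>v :: complex^'n. v \<noteq> 0 \<and> (\<chi> i j. complex_of_real (A $ i $ j)) *v v = z *s v)"

text \<open>The powers are iterated matrix products: the operations \<open>*\<close>, \<open>^\<close> and \<open>exp\<close>
  are not usable here, since multiplication on the type of matrices is componentwise.\<close>

definition matrix_exp :: "real^'n^'n \<Rightarrow> real^'n^'n" where
  "matrix_exp A = (\<Sum>k. (1 / fact k) *\<^sub>R (((**) A) ^^ k) (mat 1))"

definition cadlag :: "(real \<Rightarrow> 'a::topological_space) \<Rightarrow> bool" where
  "cadlag f \<longleftrightarrow> (\<forall>t. continuous (at_right t) f \<and> (\<exists>l. (f \<longlongrightarrow> l) (at_left t)))"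

definition D0 :: "(real \<Rightarrow> 'a::real_normed_vector) set" where
  "D0 = {w. cadlag w \<and> w 0 = 0}"

text \<open>Basic neighbourhoods of the Skorokhod (J1) topology on paths over the whole line:
  after a small increasing change of time, \<open>w'\<close> is uniformly close to \<open>w\<close> on a large compact
  interval. An increasing surjection of the reals is automatically a homeomorphism.\<close>

definition skorokhod_nbhd ::
    "(real \<Rightarrow> 'a::real_normed_vector) \<Rightarrow> real \<Rightarrow> real \<Rightarrow> (real \<Rightarrow> 'a) set" where
  "skorokhod_nbhd w T e =
     {w' \<in> D0. \<exists>l :: real \<Rightarrow> real. strict_mono l \<and> surj l \<and>
        (\<forall>t. \<bar>l t - t\<bar> < e) \<and> (\<forall>t\<in>{-T..T}. norm (w' (l t) - w t) < e)}"

definition skorokhod_open :: "(real \<Rightarrow> 'a::real_normed_vector) set \<Rightarrow> bool" where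
  "skorokhod_open U \<longleftrightarrow>
     U \<subseteq> D0 \<and> (\<forall>w\<in>U. \<exists>T>0. \<exists>e>0. skorokhod_nbhd w T e \<subseteq> U)"

definition skorokhod_borel :: "(real \<Rightarrow> 'a::real_normed_vector) measure" where
  "skorokhod_borel = sigma D0 {U. skorokhod_open U}"

definition shift :: "real \<Rightarrow> (real \<Rightarrow> 'a::real_normed_vector) \<Rightarrow> real \<Rightarrow> 'a" where
  "shift t w = (\<lambda>s. w (s + t) - w t)"

definition eq_in_distr :: "'w measure \<Rightarrow> 'b measure \<Rightarrow> ('w \<Rightarrow> 'b) \<Rightarrow> ('w \<Rightarrow> 'b) \<Rightarrow> bool" where
  "eq_in_distr M B X Y \<longleftrightarrow>
     X \<in> measurable M B \<and> Y \<in> measurable M B \<and> distr M B X = distr M B Y"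

text \<open>For independent copies \<open>X\<^sub>1\<close>, \<open>X\<^sub>2\<close> of a random vector \<open>X\<close> with the given law,
  \<open>a X\<^sub>1 + b X\<^sub>2\<close> has the law of \<open>(a\<^sup>\<alpha> + b\<^sup>\<alpha>)\<^sup>1\<^sup>/\<^sup>\<alpha> X + d\<close> for some vector \<open>d\<close>.\<close>

definition stable_law :: "real \<Rightarrow> ('a::euclidean_space) measure \<Rightarrow> bool" where
  "stable_law \<alpha> \<mu> \<longleftrightarrow>
     (\<forall>a>0. \<forall>b>0. \<exists>d.
        distr (\<mu> \<Otimes>\<^sub>M \<mu>) borel (\<lambda>(x, y). a *\<^sub>R x + b *\<^sub>R y) =
        distr \<mu> borel (\<lambda>x. ((a powr \<alpha> + b powr \<alpha>) powr (1 / \<alpha>)) *\<^sub>R x + d))"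

text \<open>The following three properties concern the coordinate process \<open>L\<^sub>t(w) = w t\<close> under a
  probability measure on path space. Its paths are cadlag and vanish at time 0 because they lie in
  \<^const>\<open>D0\<close>; together with stationarity of the increments this gives stochastic continuity.
  As the time points range over the whole real line, the process is two-sided.\<close>

definition two_sided_levy :: "(real \<Rightarrow> 'a::euclidean_space) measure \<Rightarrow> bool" where
  "two_sided_levy M \<longleftrightarrow>
     prob_space M \<and> sets M = sets skorokhod_borel \<and>
     (\<forall>(t :: nat \<Rightarrow> real) k. mono t \<longrightarrow>
        prob_space.indep_vars M (\<lambda>_. borel) (\<lambda>i w. w (t (Suc i)) - w (t i)) {..<k}) \<and>
     (\<forall>s t u. s \<le> t \<longrightarrow>
        eq_in_distr M borel (\<lambda>w. w (t + u) - w (s + u)) (\<lambda>w. w t - w s))"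

text \<open>Equality in distribution of the two processes indexed by \<open>t\<close>, that is, of their laws on the
  product of copies of the state space over all time points.\<close>

definition self_similar :: "real \<Rightarrow> (real \<Rightarrow> 'a::euclidean_space) measure \<Rightarrow> bool" where
  "self_similar \<alpha> M \<longleftrightarrow>
     (\<forall>c>0. eq_in_distr M (Pi\<^sub>M UNIV (\<lambda>_. borel))
        (\<lambda>w t. w (c * t)) (\<lambda>w t. (c powr (1 / \<alpha>)) *\<^sub>R w t))"

definition two_sided_stable_levy :: "real \<Rightarrow> (real \<Rightarrow> 'a::euclidean_space) measure \<Rightarrow> bool" where
  "two_sided_stable_levy \<alpha> M \<longleftrightarrow>
     two_sided_levy M \<and> (\<forall>t. stable_law \<alpha> (distr M borel (\<lambda>w. w t))) \<and> self_similar \<alpha> M"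

text \<open>Pathwise Riemann-Stieltjes integral of a matrix-valued function \<open>f\<close> against a vector-valued
  path \<open>L\<close>. For \<open>f\<close> continuously differentiable and \<open>L\<close> cadlag it exists on every compact interval
  and is the stochastic integral over \<open>(a, b]\<close> (the constant gauge makes this the
  Riemann-Stieltjes and not the Henstock-Stieltjes integral).\<close>

definition has_RS_integral ::
    "(real \<Rightarrow> real^'n^'m) \<Rightarrow> (real \<Rightarrow> real^'n) \<Rightarrow> real \<Rightarrow> real \<Rightarrow> real^'m \<Rightarrow> bool" where
  "has_RS_integral f L a b I \<longleftrightarrow>
     (\<forall>e>0. \<exists>d>0. \<forall>p. p tagged_division_of {a..b} \<and> (\<lambda>x. ball x d) fine p \<longrightarrow>
        norm ((\<Sum>(x, k)\<in>p. f x *v (L (Sup k) - L (Inf k))) - I) < e)"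

definition has_past_integral ::
    "(real \<Rightarrow> real^'n^'m) \<Rightarrow> (real \<Rightarrow> real^'n) \<Rightarrow> real^'m \<Rightarrow> bool" where
  "has_past_integral f L I \<longleftrightarrow>
     (\<exists>J. (\<forall>T\<ge>0. has_RS_integral f L (- T) 0 (J T)) \<and> (J \<longlongrightarrow> I) at_top)"

definition past_integral ::
    "(real \<Rightarrow> real^'n^'m) \<Rightarrow> (real \<Rightarrow> real^'n) \<Rightarrow> real^'m" where
  "past_integral f L = (THE I. has_past_integral f L I)"

definition eta :: "real^'n^'n \<Rightarrow> real \<Rightarrow> real \<Rightarrow> (real \<Rightarrow> real^'n) \<Rightarrow> real^'n" where
  "eta F \<alpha> \<epsilon> w =
     (\<epsilon> powr (- 1 / \<alpha>)) *\<^sub>R past_integral (\<lambda>s. matrix_exp ((- s / \<epsilon>) *\<^sub>R F)) w"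

definition xi :: "real^'n^'n \<Rightarrow> (real \<Rightarrow> real^'n) \<Rightarrow> real^'n" where
  "xi F w = past_integral (\<lambda>s. matrix_exp ((- s) *\<^sub>R F)) w"

definition sublinear :: "(real \<Rightarrow> 'a::real_normed_vector) \<Rightarrow> bool" where
  "sublinear f \<longleftrightarrow> ((\<lambda>t. norm (f t) / \<bar>t\<bar>) \<longlongrightarrow> 0) at_infinity"

text \<open>Shift-invariant sets of full measure on which the noise terms are defined pathwise. For a
  stable Levy law with \<open>1 < \<alpha>\<close> as above, the paths in \<^const>\<open>D0\<close> with \<open>w t / t \<rightarrow> 0\<close> as
  \<open>t \<rightarrow> \<plusminus>\<infinity>\<close> form such a set when all eigenvalues of \<open>F\<close> have negative real part.\<close>

definition good_noise_set ::
    "(real \<Rightarrow> real^'n) measure \<Rightarrow> real^'n^'n \<Rightarrow> real \<Rightarrow> (real \<Rightarrow> real^'n) set \<Rightarrow> bool" where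
  "good_noise_set M F \<alpha> \<Omega> \<longleftrightarrow>
     \<Omega> \<in> sets M \<and> measure M \<Omega> = 1 \<and> (\<forall>t. \<forall>w\<in>\<Omega>. shift t w \<in> \<Omega>) \<and>
     (\<forall>w\<in>\<Omega>.
        (\<forall>\<epsilon>>0. (\<exists>I. has_past_integral (\<lambda>s. matrix_exp ((- s / \<epsilon>) *\<^sub>R F)) w I) \<and>
                cadlag (\<lambda>t. eta F \<alpha> \<epsilon> (shift t w)) \<and> sublinear (\<lambda>t. eta F \<alpha> \<epsilon> (shift t w))) \<and>
        (\<exists>I. has_past_integral (\<lambda>s. matrix_exp ((- s) *\<^sub>R F)) w I) \<and>
        cadlag (\<lambda>t. xi F (shift t w)) \<and> sublinear (\<lambda>t. xi F (shift t w)))"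

text \<open>Functions on \<open>(-\<infinity>, 0]\<close> are represented by functions on the reals that are
  \<^const>\<open>undefined\<close> at positive times, so that uniqueness is meaningful.\<close>

definition C_fast :: "real \<Rightarrow> (real \<Rightarrow> 'a::real_normed_vector) set" where
  "C_fast \<beta> = {\<phi>. \<phi> \<in> extensional {..0} \<and> continuous_on {..0} \<phi> \<and>
                  bdd_above ((\<lambda>t. norm (exp (- \<beta> * t) *\<^sub>R \<phi> t)) ` {..0})}"

definition C_pair ::
    "real \<Rightarrow> ((real \<Rightarrow> 'a::real_normed_vector) \<times> (real \<Rightarrow> 'b::real_normed_vector)) set" where
  "C_pair \<beta> = C_fast \<beta> \<times> C_fast \<beta>"

definition slow_solution ::
    "real^'n1^'n1 \<Rightarrow> real^'n2^'n2 \<Rightarrow>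
     ((real^'n1) \<times> (real^'n2) \<Rightarrow> real^'n1) \<Rightarrow> ((real^'n1) \<times> (real^'n2) \<Rightarrow> real^'n2) \<Rightarrow>
     real \<Rightarrow> real \<Rightarrow> real \<Rightarrow> real \<Rightarrow> (real \<Rightarrow> real^'n2) \<Rightarrow> real^'n1 \<Rightarrow>
     (real \<Rightarrow> real^'n1) \<times> (real \<Rightarrow> real^'n2)" where
  "slow_solution S F g1 g2 \<sigma> \<alpha> \<gamma> \<epsilon> w x0 =
     (THE (x, y). (x, y) \<in> C_pair (- \<gamma> / \<epsilon>) \<and>
        (\<forall>t\<le>0.
           x t = matrix_exp (t *\<^sub>R S) *v x0
                 + (LBINT s=0..t. matrix_exp ((t - s) *\<^sub>R S) *v
                      g1 (x s, y s + \<sigma> *\<^sub>R eta F \<alpha> \<epsilon> (shift s w))) \<and>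
           y t = (1 / \<epsilon>) *\<^sub>R
                 (LBINT s=-\<infinity>..t. matrix_exp (((t - s) / \<epsilon>) *\<^sub>R F) *v
                    g2 (x s, y s + \<sigma> *\<^sub>R eta F \<alpha> \<epsilon> (shift s w)))))"

definition h_slow ::
    "real^'n1^'n1 \<Rightarrow> real^'n2^'n2 \<Rightarrow>
     ((real^'n1) \<times> (real^'n2) \<Rightarrow> real^'n1) \<Rightarrow> ((real^'n1) \<times> (real^'n2) \<Rightarrow> real^'n2) \<Rightarrow>
     real \<Rightarrow> real \<Rightarrow> real \<Rightarrow> real \<Rightarrow> (real \<Rightarrow> real^'n2) \<Rightarrow> real^'n1 \<Rightarrow> real^'n2" where
  "h_slow S F g1 g2 \<sigma> \<alpha> \<gamma> \<epsilon> w x0 = snd (slow_solution S F g1 g2 \<sigma> \<alpha> \<gamma> \<epsilon> w x0) 0"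

definition critical_solution ::
    "real^'n2^'n2 \<Rightarrow> ((real^'n1) \<times> (real^'n2) \<Rightarrow> real^'n2) \<Rightarrow>
     real \<Rightarrow> real \<Rightarrow> (real \<Rightarrow> real^'n2) \<Rightarrow> real^'n1 \<Rightarrow> real \<Rightarrow> real^'n2" where
  "critical_solution F g2 \<sigma> \<gamma> w x0 =
     (THE y. y \<in> C_fast (- \<gamma>) \<and>
        (\<forall>t\<le>0. y t = (LBINT s=-\<infinity>..t. matrix_exp ((t - s) *\<^sub>R F) *v
                        g2 (x0, y s + \<sigma> *\<^sub>R xi F (shift s w)))))"

definition h_critical ::
    "real^'n2^'n2 \<Rightarrow> ((real^'n1) \<times> (real^'n2) \<Rightarrow> real^'n2) \<Rightarrow>
     real \<Rightarrow> real \<Rightarrow> (real \<Rightarrow> real^'n2) \<Rightarrow> real^'n1 \<Rightarrow> real^'n2" where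
  "h_critical F g2 \<sigma> \<gamma> w x0 =
     (LBINT s=-\<infinity>..0. matrix_exp ((- s) *\<^sub>R F) *v
        g2 (x0, critical_solution F g2 \<sigma> \<gamma> w x0 s + \<sigma> *\<^sub>R xi F (shift s w)))"

definition graph_of :: "('w \<Rightarrow> 'a \<Rightarrow> 'b) \<Rightarrow> 'w \<Rightarrow> ('a \<times> 'b) set" where
  "graph_of h w = {(x0, h w x0) |x0. True}"

text \<open>The random sets \<open>Meps \<epsilon> w\<close> and \<open>M0 w\<close> are graphs over the slow variable, so \<open>heps\<close> and \<open>h0\<close>
  below are uniquely determined. For every \<open>x0\<close>,
  the fibre of the first over \<open>x0\<close> is, for all small \<open>\<epsilon>\<close>, equal in distribution to the fibre of
  the second plus a random variable that is pathwise of order \<open>\<epsilon>\<close>.\<close>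

definition manifold_converges_in_distr ::
    "'w measure \<Rightarrow> (real \<Rightarrow> 'w \<Rightarrow> ('a \<times> 'b::euclidean_space) set) \<Rightarrow> ('w \<Rightarrow> ('a \<times> 'b) set) \<Rightarrow> bool"
  where
  "manifold_converges_in_distr N Meps M0 \<longleftrightarrow>
     (\<exists>heps h0. Meps = (\<lambda>\<epsilon>. graph_of (heps \<epsilon>)) \<and> M0 = graph_of h0 \<and>
       (\<forall>x0. \<exists>r :: real \<Rightarrow> 'w \<Rightarrow> 'b.
          (\<forall>\<^sub>F \<epsilon> in at_right 0.
             r \<epsilon> \<in> borel_measurable N \<and>
             eq_in_distr N borel (\<lambda>w. heps \<epsilon> w x0) (\<lambda>w. h0 w x0 + r \<epsilon> w)) \<and>
          (\<forall>w\<in>space N. (\<lambda>\<epsilon>. norm (r \<epsilon> w)) \<in> O[at_right 0](\<lambda>\<epsilon>. \<epsilon>))))"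

end

theory Submission
  imports Defs
begin

text \<open>
  Let \<open>\<Phi>\<^sub>\<epsilon> w(t) = \<epsilon>\<^bsup>-1/\<alpha>\<^esup> w(\<epsilon>t)\<close>, which preserves the law of the noise by self-similarity. Since
  \<open>\<eta>\<^sup>1\<^sup>/\<^sup>\<epsilon>(\<theta>\<^sub>t w) = \<xi>(\<theta>\<^bsub>t/\<epsilon>\<^esub> \<Phi>\<^sub>\<epsilon> w)\<close>, passing to the time \<open>t/\<epsilon>\<close> turns the slow system at \<open>w\<close> into a system
  driven by \<open>\<xi>\<close> at the path \<open>\<Phi>\<^sub>\<epsilon> w\<close>, in which \<open>\<epsilon>\<close> occurs only as the speed of the slow variable; for
  \<open>\<epsilon> = 0\<close> it is the critical system. The integral operators of all these systems are contractions
  for the weight \<open>e\<^bsup>\<gamma>t\<^esup>\<close>. As \<open>g\<^sub>1\<close> is bounded, the slow variable stays within \<open>O(\<epsilon>|t|)\<close> of its value at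
  time 0, so the solution driven by \<open>w\<close> is within \<open>O(\<epsilon>)\<close> of the critical one. Replacing \<open>\<Phi>\<^sub>\<epsilon> w\<close> by \<open>w\<close>
  is an equality in distribution because the Picard iterates are measurable functions of the path.
\<close>

subsection \<open>The matrix exponential\<close>

text \<open>At one path \<open>w\<close> the slow solution is driven by \<open>\<xi>\<close> along
  \<open>rescale \<alpha> \<epsilon> w\<close> and the critical one by \<open>\<xi>\<close> along
  \<open>w\<close>, two noises that need not be close for small \<epsilon>. The remainder is
  therefore taken between the two solution functionals at the same path, where the noise cancels in
  every Lipschitz estimate. In the weight e^(-\<gamma> t) the fast integral costs the factor K /
  \<kappa> with \<open>\<kappa> = - (\<gamma> + \<gamma>f)\<close>, which the gap condition puts
  below 1, and the slow one costs \<delta> K / \<gamma>. Comparing the fast components alone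
  involves only K / \<kappa>, so the constant of the O(\<epsilon>) bound does not depend on
  \<epsilon>. A drift linear in |t| fits under the weight because \<gamma> |t| \<le> e^(\<gamma>
  |t|), and the bound on g1 makes its constant independent of the noise. Solutions are explicit
  limits of iterates rather than points supplied by an abstract fixed point theorem: the transfer of
  laws needs them measurable in the path.\<close>

lemma matrix_mult_norm_bound:
  obtains B :: real where "B > 0"
    "\<And>(X :: real^'n^'n) (Y :: real^'n^'n). norm (X ** Y) \<le> B * norm X * norm Y"
proof -
  have "bilinear ((**) :: real^'n^'n \<Rightarrow> real^'n^'n \<Rightarrow> real^'n^'n)"
    unfolding bilinear_def
    by (auto intro!: linearI simp: matrix_add_ldistrib matrix_matrix_mult_def vec_eq_iff
        sum.distrib algebra_simps sum_distrib_left)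
  from bilinear_bounded_pos[OF this] obtain B where
    "B > 0" "\<forall>(X :: real^'n^'n) (Y :: real^'n^'n). norm (X ** Y) \<le> B * norm X * norm Y"
    by auto
  then show ?thesis by (intro that[of B]) auto
qed

definition mpow :: "real^'n^'n \<Rightarrow> nat \<Rightarrow> real^'n^'n" where
  "mpow A k = (((**) A) ^^ k) (mat 1)"

lemma mpow_simps [simp]: "mpow A 0 = mat 1" "mpow A (Suc k) = A ** mpow A k"
  by (simp_all add: mpow_def)

lemma mpow_scaleR: "mpow (t *\<^sub>R A) k = t ^ k *\<^sub>R mpow A k"
proof (induction k)
  case (Suc k)
  then show ?case
    by (simp add: matrix_matrix_mult_def vec_eq_iff sum_distrib_left algebra_simps)
qed simp

lemma mpow_bound:
  fixes A :: "real^'n^'n"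
  obtains b where "b \<ge> 0" "\<And>k. norm (mpow A k) \<le> norm (mat 1 :: real^'n^'n) * b ^ k"
proof -
  obtain B :: real where B: "B > 0" "\<And>(X :: real^'n^'n) (Y :: real^'n^'n). norm (X ** Y) \<le> B * norm X * norm Y"
    using matrix_mult_norm_bound by blast
  have "norm (mpow A k) \<le> norm (mat 1 :: real^'n^'n) * (B * norm A) ^ k" for k
  proof (induction k)
    case (Suc k)
    have "norm (mpow A (Suc k)) \<le> B * norm A * norm (mpow A k)"
      using B(2)[of A "mpow A k"] by simp
    also have "\<dots> \<le> B * norm A * (norm (mat 1 :: real^'n^'n) * (B * norm A) ^ k)"
      using B(1) Suc by (intro mult_left_mono) auto
    finally show ?case by (simp add: algebra_simps)
  qed simp
  then show ?thesis using that[of "B * norm A"] B(1) by simp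
qed

text \<open>Domination by the scalar exponential series of |t| b. The norms are summed so that the
  lemma can also serve as a majorant for single entries.\<close>

lemma summable_matrix_exp:
  fixes A :: "real^'n^'n"
  shows "summable (\<lambda>k. norm ((t ^ k / fact k) *\<^sub>R mpow A k))"
proof -
  obtain b where b: "b \<ge> 0" "\<And>k. norm (mpow A k) \<le> norm (mat 1 :: real^'n^'n) * b ^ k"
    using mpow_bound by blast
  have sum: "summable (\<lambda>k. norm (mat 1 :: real^'n^'n) * (inverse (fact k) * (\<bar>t\<bar> * b) ^ k))"
    by (intro summable_mult summable_exp)
  have le: "norm ((t ^ k / fact k) *\<^sub>R mpow A k)
      \<le> norm (mat 1 :: real^'n^'n) * (inverse (fact k) * (\<bar>t\<bar> * b) ^ k)" for k
    using mult_left_mono[OF b(2)[of k], of "\<bar>t\<bar> ^ k / fact k"]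
    by (simp add: power_abs power_mult_distrib abs_mult field_simps)
  show ?thesis
    by (rule summable_comparison_test'[OF sum, of 0]) (use le in simp)
qed

lemma matrix_exp_scaleR:
  "matrix_exp (t *\<^sub>R A) = (\<Sum>k. (t ^ k / fact k) *\<^sub>R mpow A k)"
  unfolding matrix_exp_def mpow_def[symmetric] mpow_scaleR by simp

text \<open>Each entry is a scalar power series in t that converges everywhere.\<close>

lemma continuous_on_matrix_exp:
  fixes A :: "real^'n^'n"
  shows "continuous_on UNIV (\<lambda>t. matrix_exp (t *\<^sub>R A))"
proof -
  have comp: "matrix_exp (t *\<^sub>R A) $ i $ j = (\<Sum>k. (mpow A k $ i $ j / fact k) * t ^ k)" for t i j
  proof -
    have "bounded_linear (\<lambda>X :: real^'n^'n. X $ i $ j)"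
      using bounded_linear_compose[OF bounded_linear_vec_nth bounded_linear_vec_nth] .
    from bounded_linear.suminf[OF this summable_norm_cancel[OF summable_matrix_exp]]
    show ?thesis unfolding matrix_exp_scaleR by (simp add: algebra_simps)
  qed
  have "isCont (\<lambda>t. matrix_exp (t *\<^sub>R A) $ i $ j) t" for t i j
  proof -
    have "summable (\<lambda>k. (mpow A k $ i $ j / fact k) * s ^ k)" for s
    proof (rule summable_comparison_test'[where N = 0, OF summable_matrix_exp[of s A]])
      fix k
      have "\<bar>mpow A k $ i $ j\<bar> \<le> norm (mpow A k)"
        using component_le_norm_cart[of "mpow A k $ i" j] Finite_Cartesian_Product.norm_nth_le[of "mpow A k" i] by simp
      from mult_left_mono[OF this, of "\<bar>s\<bar> ^ k / fact k"]
      show "norm ((mpow A k $ i $ j / fact k) * s ^ k) \<le> norm ((s ^ k / fact k) *\<^sub>R mpow A k)"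
        by (simp add: abs_mult power_abs algebra_simps)
    qed
    \<comment> \<open>Continuity at t is obtained from convergence at a point of strictly larger
      modulus, here |t| + 1.\<close>
    from isCont_powser[OF this[of "\<bar>t\<bar> + 1"], of t] show ?thesis
      unfolding comp by simp
  qed
  then have "continuous_on UNIV (\<lambda>t. \<chi> i j. matrix_exp (t *\<^sub>R A) $ i $ j)"
    by (intro continuous_on_vec_lambda continuous_at_imp_continuous_on) blast
  then show ?thesis by simp
qed

lemma continuous_on_matrix_vector_mult:
  fixes A :: "'a::topological_space \<Rightarrow> real^'n^'m"
  assumes "continuous_on X A" "continuous_on X f"
  shows "continuous_on X (\<lambda>x. A x *v f x)"
  unfolding matrix_mult_dot by (intro continuous_intros assms)

lemma matrix_exp_flow_continuous:
  fixes A :: "real^'n^'n"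
  shows "continuous_on UNIV (\<lambda>(t, x). matrix_exp (t *\<^sub>R A) *v x)"
  unfolding split_beta
  by (intro continuous_on_matrix_vector_mult continuous_intros
      continuous_on_compose2[OF continuous_on_matrix_exp]) auto

text \<open>The constant term of the series cancels against the identity, and for |t| \<le> 1 every
  remaining power is at most |t|. What is left is the series at t = 1 without its first
  term.\<close>

lemma matrix_exp_near_id:
  fixes A :: "real^'n^'n"
  obtains D where "D \<ge> 0"
    "\<And>t x. \<bar>t\<bar> \<le> 1 \<Longrightarrow> norm (matrix_exp (t *\<^sub>R A) *v x - x) \<le> D * \<bar>t\<bar> * norm x"
proof -
  let ?c = "\<lambda>k. norm ((1 / fact k) *\<^sub>R mpow A k)"
  define D where "D = (\<Sum>k. ?c (Suc k))"
  have sc: "summable (\<lambda>k. ?c (Suc k))"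
    using summable_matrix_exp[of 1 A] by (subst summable_Suc_iff) simp
  have D0: "D \<ge> 0" unfolding D_def by (intro suminf_nonneg sc) simp
  have bil: "bilinear ((*v) :: real^'n^'n \<Rightarrow> real^'n \<Rightarrow> real^'n)"
    unfolding bilinear_def
    by (auto intro!: linearI simp: matrix_vector_mult_def vec_eq_iff
        sum.distrib algebra_simps sum_distrib_left)
  obtain B :: real where B: "B > 0"
      "\<And>(X :: real^'n^'n) x. norm (X *v x) \<le> B * norm X * norm x"
    using bilinear_bounded_pos[OF bil] by auto
  have near: "norm (matrix_exp (t *\<^sub>R A) - mat 1) \<le> D * \<bar>t\<bar>" if t: "\<bar>t\<bar> \<le> 1" for t
  proof -
    let ?f = "\<lambda>k. (t ^ k / fact k) *\<^sub>R mpow A k"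
    have le: "norm (?f (Suc k)) \<le> \<bar>t\<bar> * ?c (Suc k)" for k
    proof -
      have "\<bar>t\<bar> ^ k \<le> 1" using t by (simp add: power_le_one)
      then have "\<bar>t\<bar> * \<bar>t\<bar> ^ k * (norm (mpow A (Suc k)) / fact (Suc k))
          \<le> \<bar>t\<bar> * 1 * (norm (mpow A (Suc k)) / fact (Suc k))"
        by (intro mult_right_mono mult_left_mono) auto
      then show ?thesis by (simp add: abs_mult power_abs del: mpow_simps fact_Suc)
    qed
    have s: "summable ?f" by (rule summable_norm_cancel[OF summable_matrix_exp])
    have "matrix_exp (t *\<^sub>R A) - mat 1 = (\<Sum>k. ?f (Suc k))"
      unfolding matrix_exp_scaleR suminf_split_head[OF s] by simp
    also have "norm \<dots> \<le> (\<Sum>k. \<bar>t\<bar> * ?c (Suc k))"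
      by (rule norm_suminf_le[OF le]) (intro summable_mult sc)
    also have "\<dots> = D * \<bar>t\<bar>"
      unfolding D_def by (subst suminf_mult[OF sc]) simp
    finally show ?thesis .
  qed
  have "norm (matrix_exp (t *\<^sub>R A) *v x - x) \<le> (B * D) * \<bar>t\<bar> * norm x" if t: "\<bar>t\<bar> \<le> 1" for t x
  proof -
    have "matrix_exp (t *\<^sub>R A) *v x - x = (matrix_exp (t *\<^sub>R A) - mat 1) *v x"
      by (simp add: matrix_vector_mult_diff_rdistrib)
    also have "norm \<dots> \<le> B * norm (matrix_exp (t *\<^sub>R A) - mat 1) * norm x" by (rule B)
    also have "\<dots> \<le> B * (D * \<bar>t\<bar>) * norm x"
      using B(1) near[OF t] by (intro mult_right_mono mult_left_mono) auto
    finally show ?thesis by (simp add: algebra_simps)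
  qed
  then show ?thesis using that[of "B * D"] B(1) D0 by simp
qed

text \<open>Beyond |t| = 1 the contraction property alone bounds the displacement by 2 |x| \<le> 2
  |t| |x|, hence the constant D + 2. The slow flow is compared with its starting point on the whole
  past, so the estimate must not stop at |t| = 1.\<close>

lemma matrix_exp_contraction_near_id:
  fixes A :: "real^'n^'n"
  assumes contr: "\<And>t x. t \<le> 0 \<Longrightarrow> norm (matrix_exp (t *\<^sub>R A) *v x) \<le> norm x"
  obtains D where "D \<ge> 0"
    "\<And>t x. t \<le> 0 \<Longrightarrow> norm (matrix_exp (t *\<^sub>R A) *v x - x) \<le> D * \<bar>t\<bar> * norm x"
proof -
  obtain D where D: "D \<ge> 0"
    "\<And>t x. \<bar>t\<bar> \<le> 1 \<Longrightarrow> norm (matrix_exp (t *\<^sub>R A) *v x - x) \<le> D * \<bar>t\<bar> * norm x"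
    using matrix_exp_near_id by blast
  have "norm (matrix_exp (t *\<^sub>R A) *v x - x) \<le> (D + 2) * \<bar>t\<bar> * norm x" if t: "t \<le> 0" for t x
  proof (cases "\<bar>t\<bar> \<le> 1")
    case True
    have "D * \<bar>t\<bar> * norm x \<le> (D + 2) * \<bar>t\<bar> * norm x"
      by (intro mult_right_mono) auto
    then show ?thesis using D(2)[OF True, of x] by linarith
  next
    case False
    have "norm (matrix_exp (t *\<^sub>R A) *v x - x) \<le> 2 * norm x"
      using norm_triangle_ineq4[of "matrix_exp (t *\<^sub>R A) *v x" x] contr[OF t, of x] by linarith
    also have "\<dots> \<le> ((D + 2) * \<bar>t\<bar>) * norm x"
    proof (rule mult_right_mono)
      have "2 * 1 \<le> (D + 2) * \<bar>t\<bar>" using False D(1) by (intro mult_mono) auto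
      then show "2 \<le> (D + 2) * \<bar>t\<bar>" by simp
    qed simp
    finally show ?thesis .
  qed
  then show ?thesis using that[of "D + 2"] D(1) by simp
qed

subsection \<open>The slow-fast integral equations\<close>

lemma norm_fst_le': "norm (fst p) \<le> norm p" and norm_snd_le': "norm (snd p) \<le> norm p"
  using norm_fst_le[of "fst p" "snd p"] norm_snd_le[of "snd p" "fst p"] by simp_all

section \<open>Exponential majorants and iterated weighted bounds\<close>

lemma has_bochner_integral_exp_past:
  fixes \<kappa> t :: real
  assumes "\<kappa> > 0"
  shows "has_bochner_integral lborel (\<lambda>s. indicator {..<t} s * exp (\<kappa> * s)) (exp (\<kappa> * t) / \<kappa>)"
proof -
  have "has_bochner_integral lborel (\<lambda>x::real. x ^ 0 * exp (- x) * indicator {0<..} x) (fact 0)"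
    by (rule has_bochner_integral_I0i_power_exp_m)
  \<comment> \<open>Substitution x = \<kappa> t - \<kappa> s, which maps s < t onto x > 0.\<close>
  from lborel_has_bochner_integral_real_affine_iff[of "- \<kappa>" "\<lambda>x. exp (- x) * indicator {0<..} x" 1 "\<kappa> * t"]
    this assms
  have "has_bochner_integral lborel
      (\<lambda>s. exp (\<kappa> * s - \<kappa> * t) * indicator {0<..} (\<kappa> * t - \<kappa> * s)) (1 / \<kappa>)"
    by (simp add: divide_inverse)
  from has_bochner_integral_mult_right[OF this, of "exp (\<kappa> * t)"]
  have "has_bochner_integral lborel
      (\<lambda>s. exp (\<kappa> * t) * (exp (\<kappa> * s - \<kappa> * t) * indicator {0<..} (\<kappa> * t - \<kappa> * s)))
      (exp (\<kappa> * t) / \<kappa>)"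
    by simp
  moreover have "exp (\<kappa> * t) * (exp (\<kappa> * s - \<kappa> * t) * indicator {0<..} (\<kappa> * t - \<kappa> * s))
      = indicator {..<t} s * exp (\<kappa> * s)" for s
    using assms by (simp add: exp_diff indicator_def)
  ultimately show ?thesis by simp
qed

lemma has_bochner_integral_exp_future:
  fixes \<gamma> t :: real
  assumes "\<gamma> > 0"
  shows "has_bochner_integral lborel (\<lambda>s. indicator {t<..} s * exp (- \<gamma> * s)) (exp (- \<gamma> * t) / \<gamma>)"
  using lborel_has_bochner_integral_real_affine_iff[of "-1"
      "\<lambda>s. indicator {..<- t} s * exp (\<gamma> * s)" "exp (- \<gamma> * t) / \<gamma>" 0]
    has_bochner_integral_exp_past[OF assms, of "- t"]
  by (simp add: indicator_def)

lemma integrable_and_norm_integral_le: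
  fixes f :: "'w \<Rightarrow> 'a::{banach, second_countable_topology}"
  assumes "f \<in> borel_measurable M" "has_bochner_integral M g v" "\<And>x. norm (f x) \<le> g x"
  shows "integrable M f" "norm (\<integral>x. f x \<partial>M) \<le> v"
proof -
  have g: "integrable M g" "(\<integral>x. g x \<partial>M) = v"
    using assms(2) by (auto simp: has_bochner_integral_iff)
  show f: "integrable M f"
    by (rule Bochner_Integration.integrable_bound[OF g(1) assms(1)])
      (use assms(3) in \<open>auto intro: order_trans[OF _ abs_ge_self]\<close>)
  have "norm (\<integral>x. f x \<partial>M) \<le> (\<integral>x. norm (f x) \<partial>M)" by (rule integral_norm_bound)
  also have "\<dots> \<le> (\<integral>x. g x \<partial>M)"
    by (intro integral_mono integrable_norm f g(1) assms(3))
  finally show "norm (\<integral>x. f x \<partial>M) \<le> v" using g(2) by simp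
qed

text \<open>Iterating N -> a + \<rho> N from any starting bound converges to a / (1 - \<rho>),
  whatever N was. With a = 0 this gives uniqueness; with a of order \<delta> it gives the distance
  to the critical solution. No supremum of e has to be formed.\<close>

lemma weighted_contraction_bound:
  fixes e :: "real \<Rightarrow> real"
  assumes \<rho>: "0 \<le> \<rho>" "\<rho> < 1"
    and init: "\<And>s. s \<le> 0 \<Longrightarrow> e s \<le> N * exp (- \<gamma> * s)"
    and step: "\<And>N s. (\<And>s. s \<le> 0 \<Longrightarrow> e s \<le> N * exp (- \<gamma> * s)) \<Longrightarrow> s \<le> 0
                 \<Longrightarrow> e s \<le> (a + \<rho> * N) * exp (- \<gamma> * s)"
    and "s \<le> 0"
  shows "e s \<le> a / (1 - \<rho>) * exp (- \<gamma> * s)"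
proof -
  let ?M = "\<lambda>k. a / (1 - \<rho>) + \<rho> ^ k * (N - a / (1 - \<rho>))"
  have bound: "e s \<le> ?M k * exp (- \<gamma> * s)" if "s \<le> 0" for k s
    using that
  proof (induction k arbitrary: s)
    case 0
    then show ?case using init by simp
  next
    case (Suc k)
    have "a + \<rho> * (a / (1 - \<rho>)) = a / (1 - \<rho>)" using \<rho>(2) by (simp add: field_simps)
    then have "a + \<rho> * ?M k = ?M (Suc k)" by (simp add: distrib_left)
    then show ?case using step[OF Suc.IH Suc.prems] by simp
  qed
  have "(\<lambda>k. ?M k * exp (- \<gamma> * s)) \<longlonglongrightarrow> (a / (1 - \<rho>) + 0 * (N - a / (1 - \<rho>))) * exp (- \<gamma> * s)"
    using \<rho> by (intro tendsto_intros LIMSEQ_realpow_zero) auto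
  then show ?thesis
    using LIMSEQ_le_const[of "\<lambda>k. ?M k * exp (- \<gamma> * s)"] bound[OF \<open>s \<le> 0\<close>] by auto
qed

text \<open>Collects what the estimates use of the exponentials: \<open>U\<close> stands for e^(tS),
  contractive backwards in time, and \<open>V\<close> for e^(tF), decaying at rate
  \<open>\<gamma>f\<close>. \<open>D\<close> is the constant of the displacement bound and
  \<open>C\<close> the bound on \<open>g1\<close>.\<close>

locale slow_fast =
  fixes U :: "real \<Rightarrow> 'a::euclidean_space \<Rightarrow> 'a" and V :: "real \<Rightarrow> 'b::euclidean_space \<Rightarrow> 'b"
    and g1 :: "'a \<times> 'b \<Rightarrow> 'a" and g2 :: "'a \<times> 'b \<Rightarrow> 'b"
    and \<gamma> \<gamma>f K C D :: real
  assumes U_cont: "continuous_on UNIV (\<lambda>(t, x). U t x)" and U_linear: "linear (U t)"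
    and V_cont: "continuous_on UNIV (\<lambda>(t, y). V t y)" and V_linear: "linear (V t)"
    and U_bound: "t \<le> 0 \<Longrightarrow> norm (U t x) \<le> norm x"
    and U_near: "t \<le> 0 \<Longrightarrow> norm (U t x - x) \<le> D * \<bar>t\<bar> * norm x"
    and V_bound: "t \<ge> 0 \<Longrightarrow> norm (V t y) \<le> exp (\<gamma>f * t) * norm y"
    and g1_lip: "norm (g1 (x1, y1) - g1 (x2, y2)) \<le> K * (norm (x1 - x2) + norm (y1 - y2))"
    and g2_lip: "norm (g2 (x1, y1) - g2 (x2, y2)) \<le> K * (norm (x1 - x2) + norm (y1 - y2))"
    and g1_zero: "g1 (0, 0) = 0" and g2_zero: "g2 (0, 0) = 0"
    and g1_bound: "norm (g1 p) \<le> C"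
    and pos: "\<gamma> > 0" "K > 0" "D \<ge> 0" and gap: "K < - (\<gamma> + \<gamma>f)"
begin

text \<open>The rate left when the decay of \<open>V\<close> is charged with the weight:
  \<open>\<gamma>f * (t - s) - \<gamma> * s = \<gamma>f * t + \<kappa> * s\<close>.\<close>

definition \<kappa> :: real where "\<kappa> = - (\<gamma> + \<gamma>f)"

lemma \<kappa>: "\<kappa> > 0" "K / \<kappa> < 1" "K / \<kappa> > 0"
  using gap pos by (auto simp: \<kappa>_def)

lemma \<gamma>f_neg: "\<gamma>f < 0"
  using gap pos by simp

lemma C_nonneg: "C \<ge> 0"
  using g1_bound[of "(0, 0)"] norm_ge_zero order_trans by blast

lemma continuous_on_g1: "continuous_on UNIV g1" and continuous_on_g2: "continuous_on UNIV g2"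
proof -
  have *: "continuous_on UNIV g"
    if g: "\<And>x1 y1 x2 y2. norm (g (x1, y1) - g (x2, y2)) \<le> K * (norm (x1 - x2) + norm (y1 - y2))"
    for g :: "'a \<times> 'b \<Rightarrow> 'c::euclidean_space"
  proof -
    have "(2 * K)-lipschitz_on UNIV g"
    proof (rule lipschitz_onI)
      fix p q :: "'a \<times> 'b"
      have "norm (g p - g q) \<le> K * (norm (fst p - fst q) + norm (snd p - snd q))"
        using g[of "fst p" "snd p" "fst q" "snd q"] by simp
      \<comment> \<open>The 2 is the price of passing from the sum of the component norms to the
        norm of the pair.\<close>
      also have "\<dots> \<le> K * (2 * norm (p - q))"
        using norm_fst_le'[of "p - q"] norm_snd_le'[of "p - q"] pos
        by (intro mult_left_mono) auto
      finally show "dist (g p) (g q) \<le> 2 * K * dist p q" by (simp add: dist_norm)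
    qed (use pos in simp)
    then show ?thesis by (rule lipschitz_on_continuous_on)
  qed
  show "continuous_on UNIV g1" "continuous_on UNIV g2"
    by (rule *, rule g1_lip) (rule *, rule g2_lip)
qed

lemma g1_measurable [measurable]: "g1 \<in> borel_measurable (borel \<Otimes>\<^sub>M borel)"
  and g2_measurable [measurable]: "g2 \<in> borel_measurable (borel \<Otimes>\<^sub>M borel)"
  unfolding borel_prod
  by (rule borel_measurable_continuous_onI, rule continuous_on_g1)
    (rule borel_measurable_continuous_onI, rule continuous_on_g2)

lemma U_measurable [measurable (raw)]:
  "a \<in> borel_measurable M \<Longrightarrow> b \<in> borel_measurable M \<Longrightarrow> (\<lambda>x. U (a x) (b x)) \<in> borel_measurable M"
  using U_cont borel_measurable_continuous_Pair[of a M b U] by (simp add: split_beta)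

lemma V_measurable [measurable (raw)]:
  "a \<in> borel_measurable M \<Longrightarrow> b \<in> borel_measurable M \<Longrightarrow> (\<lambda>x. V (a x) (b x)) \<in> borel_measurable M"
  using V_cont borel_measurable_continuous_Pair[of a M b V] by (simp add: split_beta)

section \<open>Integrals over the past and their weighted bounds\<close>

definition past :: "real \<Rightarrow> (real \<Rightarrow> 'b) \<Rightarrow> 'b" where
  "past t f = (LINT s:{..<t}|lborel. V (t - s) (f s))"

text \<open>The interval is oriented upwards, opposite to an integral from 0 to t \<le> 0; this
  produces the minus sign in \<open>integral_op\<close>. In fast time the slow flow runs at speed
  \<delta>.\<close>

definition recent :: "real \<Rightarrow> real \<Rightarrow> (real \<Rightarrow> 'a) \<Rightarrow> 'a" where
  "recent \<delta> t f = (LINT s:{t<..<0}|lborel. U (\<delta> * (t - s)) (f s))"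

lemma V_weighted_bound:
  assumes "norm y \<le> N * exp (- \<gamma> * s)" "s \<le> t"
  shows "norm (V (t - s) y) \<le> N * exp (\<gamma>f * t) * exp (\<kappa> * s)"
proof -
  have "norm (V (t - s) y) \<le> exp (\<gamma>f * (t - s)) * norm y" using assms V_bound by simp
  also have "\<dots> \<le> exp (\<gamma>f * (t - s)) * (N * exp (- \<gamma> * s))" using assms by simp
  also have "\<dots> = N * exp (\<gamma>f * (t - s) + (- \<gamma> * s))" unfolding exp_add by simp
  also have "\<gamma>f * (t - s) + (- \<gamma> * s) = \<gamma>f * t + \<kappa> * s" by (simp add: \<kappa>_def algebra_simps)
  finally show ?thesis by (simp add: exp_add)
qed

text \<open>The majorant e^(\<open>\<gamma>f\<close> t) e^(\<kappa> s) integrates over s < t to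
  e^(-\<gamma> t) / \<kappa>: the weight is reproduced and the operator costs 1 / \<kappa>.\<close>

lemma
  assumes [measurable]: "f \<in> borel_measurable borel"
    and f: "\<And>s. s \<le> 0 \<Longrightarrow> norm (f s) \<le> N * exp (- \<gamma> * s)" and "t \<le> 0"
  shows past_integrable: "set_integrable lborel {..<t} (\<lambda>s. V (t - s) (f s))"
    and norm_past_le: "norm (past t f) \<le> N / \<kappa> * exp (- \<gamma> * t)"
proof -
  let ?g = "\<lambda>s. N * exp (\<gamma>f * t) * (indicator {..<t} s * exp (\<kappa> * s))"
  have m: "(\<lambda>s. indicator {..<t} s *\<^sub>R V (t - s) (f s)) \<in> borel_measurable lborel" by measurable
  have g: "has_bochner_integral lborel ?g (N * exp (\<gamma>f * t) * (exp (\<kappa> * t) / \<kappa>))"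
    by (intro has_bochner_integral_mult_right has_bochner_integral_exp_past \<kappa>)
  have le: "norm (indicator {..<t} s *\<^sub>R V (t - s) (f s)) \<le> ?g s" for s
    using V_weighted_bound[OF f, of s t] \<open>t \<le> 0\<close> by (simp add: indicator_def)
  have "exp (\<gamma>f * t) * exp (\<kappa> * t) = exp (- \<gamma> * t)"
    by (simp add: exp_add[symmetric] \<kappa>_def algebra_simps)
  then have eq: "N * exp (\<gamma>f * t) * (exp (\<kappa> * t) / \<kappa>) = N / \<kappa> * exp (- \<gamma> * t)"
    by (simp add: mult.assoc)
  from integrable_and_norm_integral_le[OF m g[unfolded eq] le]
  show "set_integrable lborel {..<t} (\<lambda>s. V (t - s) (f s))"
    "norm (past t f) \<le> N / \<kappa> * exp (- \<gamma> * t)"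
    by (simp_all add: past_def set_integrable_def set_lebesgue_integral_def)
qed

lemma past_diff:
  assumes [measurable]: "f \<in> borel_measurable borel" "g \<in> borel_measurable borel"
    and "\<And>s. s \<le> 0 \<Longrightarrow> norm (f s) \<le> N * exp (- \<gamma> * s)"
      "\<And>s. s \<le> 0 \<Longrightarrow> norm (g s) \<le> N' * exp (- \<gamma> * s)" and "t \<le> 0"
  shows "past t f - past t g = past t (\<lambda>s. f s - g s)"
  unfolding past_def
  by (subst set_integral_diff(2)[symmetric])
    (use assms in \<open>auto intro!: past_integrable simp: linear_diff[OF V_linear]\<close>)

text \<open>Since \<delta> (t - s) \<le> 0 the flow is a contraction here, so the cost is that of
  integrating the weight over s > t, namely 1 / \<gamma>, uniformly in \<delta> and also for
  \<delta> = 0.\<close>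

lemma
  assumes [measurable]: "f \<in> borel_measurable borel"
    and f: "\<And>s. s \<le> 0 \<Longrightarrow> norm (f s) \<le> N * exp (- \<gamma> * s)" and "t \<le> 0" "\<delta> \<ge> 0"
  shows recent_integrable: "set_integrable lborel {t<..<0} (\<lambda>s. U (\<delta> * (t - s)) (f s))"
    and norm_recent_le: "norm (recent \<delta> t f) \<le> N / \<gamma> * exp (- \<gamma> * t)"
proof -
  let ?g = "\<lambda>s. N * (indicator {t<..} s * exp (- \<gamma> * s))"
  have m: "(\<lambda>s. indicator {t<..<0} s *\<^sub>R U (\<delta> * (t - s)) (f s)) \<in> borel_measurable lborel"
    by measurable
  have g: "has_bochner_integral lborel ?g (N * (exp (- \<gamma> * t) / \<gamma>))"
    by (intro has_bochner_integral_mult_right has_bochner_integral_exp_future pos)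
  have "N \<ge> 0" using f[of 0] norm_ge_zero[of "f 0"] by (simp del: norm_ge_zero)
  then have le: "norm (indicator {t<..<0} s *\<^sub>R U (\<delta> * (t - s)) (f s)) \<le> ?g s" for s
    using order_trans[OF U_bound[of "\<delta> * (t - s)" "f s"] f[of s]] \<open>\<delta> \<ge> 0\<close>
    by (auto simp: indicator_def mult_nonneg_nonpos)
  from integrable_and_norm_integral_le[OF m g le]
  show "set_integrable lborel {t<..<0} (\<lambda>s. U (\<delta> * (t - s)) (f s))"
    "norm (recent \<delta> t f) \<le> N / \<gamma> * exp (- \<gamma> * t)"
    by (simp_all add: recent_def set_integrable_def set_lebesgue_integral_def)
qed

text \<open>For a bounded integrand the length of the interval replaces the weight. Applied to
  \<open>g1\<close> this yields a drift bound that knows nothing of the noise or of the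
  solution.\<close>

lemma norm_recent_le_linear:
  assumes [measurable]: "f \<in> borel_measurable borel"
    and f: "\<And>s. norm (f s) \<le> C" and "t \<le> 0" "\<delta> \<ge> 0"
  shows "norm (recent \<delta> t f) \<le> C * \<bar>t\<bar>"
proof -
  let ?g = "\<lambda>s::real. C * indicator {t<..<0} s"
  have m: "(\<lambda>s. indicator {t<..<0} s *\<^sub>R U (\<delta> * (t - s)) (f s)) \<in> borel_measurable lborel"
    by measurable
  have "has_bochner_integral lborel (indicator {t<..<0} :: real \<Rightarrow> real) (measure lborel {t<..<0})"
    by (rule has_bochner_integral_real_indicator) (use \<open>t \<le> 0\<close> in auto)
  then have g: "has_bochner_integral lborel ?g (C * \<bar>t\<bar>)"
    using \<open>t \<le> 0\<close> by (intro has_bochner_integral_mult_right) auto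
  have le: "norm (indicator {t<..<0} s *\<^sub>R U (\<delta> * (t - s)) (f s)) \<le> ?g s" for s
    using order_trans[OF U_bound[of "\<delta> * (t - s)" "f s"] f[of s]] \<open>\<delta> \<ge> 0\<close>
    by (auto simp: indicator_def mult_nonneg_nonpos)
  from integrable_and_norm_integral_le[OF m g le] show ?thesis
    by (simp add: recent_def set_lebesgue_integral_def)
qed

lemma recent_diff:
  assumes [measurable]: "f \<in> borel_measurable borel" "g \<in> borel_measurable borel"
    and "\<And>s. s \<le> 0 \<Longrightarrow> norm (f s) \<le> N * exp (- \<gamma> * s)"
      "\<And>s. s \<le> 0 \<Longrightarrow> norm (g s) \<le> N' * exp (- \<gamma> * s)" and "t \<le> 0" "\<delta> \<ge> 0"
  shows "recent \<delta> t f - recent \<delta> t g = recent \<delta> t (\<lambda>s. f s - g s)"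
  unfolding recent_def
  by (subst set_integral_diff(2)[symmetric])
    (use assms in \<open>auto intro!: recent_integrable simp: linear_diff[OF U_linear]\<close>)

lemma tendsto_U:
  assumes "(a \<longlongrightarrow> l) net"
  shows "((\<lambda>n. U (a n) x) \<longlongrightarrow> U l x) net"
  using isCont_tendsto_compose[of "(l, x)" "\<lambda>(t, x). U t x" "\<lambda>n. (a n, x)" net]
    tendsto_Pair[OF assms tendsto_const[of x]] U_cont
  by (simp add: continuous_on_eq_continuous_at)

lemma tendsto_V:
  assumes "(a \<longlongrightarrow> l) net"
  shows "((\<lambda>n. V (a n) x) \<longlongrightarrow> V l x) net"
  using isCont_tendsto_compose[of "(l, x)" "\<lambda>(t, x). V t x" "\<lambda>n. (a n, x)" net]
    tendsto_Pair[OF assms tendsto_const[of x]] V_cont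
  by (simp add: continuous_on_eq_continuous_at)

text \<open>Dominated convergence along sequences; the indicators converge except at the single
  point s = a.\<close>

lemma continuous_on_past:
  assumes [measurable]: "f \<in> borel_measurable borel"
    and f: "\<And>s. s \<le> 0 \<Longrightarrow> norm (f s) \<le> N * exp (- \<gamma> * s)"
  shows "continuous_on {..0} (\<lambda>t. past t f)"
proof (unfold continuous_on_sequentially o_def, intro allI ballI impI, elim conjE)
  fix x :: "nat \<Rightarrow> real" and a assume "\<forall>n. x n \<in> {..0}" "x \<longlonglongrightarrow> a"
  then have x: "x n \<le> 0" for n by simp
  obtain B where B: "\<And>n. \<bar>x n\<bar> \<le> B"
    using convergent_imp_Bseq[OF convergentI[OF \<open>x \<longlonglongrightarrow> a\<close>]] by (auto simp: Bseq_def)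
  have N: "N \<ge> 0" using f[of 0] norm_ge_zero[of "f 0"] by (simp del: norm_ge_zero)
  let ?h = "\<lambda>t s. indicator {..<t} s *\<^sub>R V (t - s) (f s)"
  \<comment> \<open>As \<open>\<gamma>f\<close> is negative and every \<open>x n\<close> is at least
    -B, this factor dominates exp (\<open>\<gamma>f * x n\<close>) for all n.\<close>
  let ?g = "\<lambda>s. N * exp (\<gamma>f * - B) * (indicator {..<0} s * exp (\<kappa> * s))"
  have "(\<lambda>n. \<integral>s. ?h (x n) s \<partial>lborel) \<longlonglongrightarrow> (\<integral>s. ?h a s \<partial>lborel)"
  proof (rule integral_dominated_convergence)
    show "integrable lborel ?g"
      using has_bochner_integral_exp_past[OF \<kappa>(1), of 0] by (auto simp: has_bochner_integral_iff)
    show "AE s in lborel. (\<lambda>n. ?h (x n) s) \<longlonglongrightarrow> ?h a s"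
      using AE_lborel_singleton[of a]
    proof eventually_elim
      case (elim s)
      have "(\<lambda>n. indicator {..<x n} s :: real) \<longlonglongrightarrow> indicator {..<a} s"
      proof (rule tendsto_eventually)
        from elim consider "s < a" | "s > a" by linarith
        then show "\<forall>\<^sub>F n in sequentially. indicator {..<x n} s = (indicator {..<a} s :: real)"
        proof cases
          case 1 from order_tendstoD(1)[OF \<open>x \<longlonglongrightarrow> a\<close> this] show ?thesis
            by eventually_elim (use 1 in auto)
        next
          case 2 from order_tendstoD(2)[OF \<open>x \<longlonglongrightarrow> a\<close> this] show ?thesis
            by eventually_elim (use 2 in auto)
        qed
      qed
      moreover have "(\<lambda>n. V (x n - s) (f s)) \<longlonglongrightarrow> V (a - s) (f s)"
        by (intro tendsto_V tendsto_intros \<open>x \<longlonglongrightarrow> a\<close>)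
      ultimately show ?case by (rule tendsto_scaleR)
    qed
    show "AE s in lborel. norm (?h (x n) s) \<le> ?g s" for n
    proof (intro AE_I2)
      fix s
      show "norm (?h (x n) s) \<le> ?g s"
      proof (cases "s < x n")
        case True
        have "norm (V (x n - s) (f s)) \<le> N * exp (\<gamma>f * x n) * exp (\<kappa> * s)"
          using V_weighted_bound[OF f, of s "x n"] True x[of n] by simp
        also have "\<dots> \<le> N * exp (\<gamma>f * - B) * exp (\<kappa> * s)"
        proof -
          have "\<gamma>f * x n \<le> \<gamma>f * - B" using \<gamma>f_neg B[of n] by (intro mult_left_mono_neg) auto
          then show ?thesis using N by (intro mult_right_mono mult_left_mono) auto
        qed
        finally show ?thesis using True x[of n] by simp
      qed (use N in simp)
    qed
  qed measurable
  then show "(\<lambda>n. past (x n) f) \<longlonglongrightarrow> past a f"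
    by (simp add: past_def set_lebesgue_integral_def)
qed

lemma continuous_on_recent:
  assumes [measurable]: "f \<in> borel_measurable borel"
    and f: "\<And>s. s \<le> 0 \<Longrightarrow> norm (f s) \<le> N * exp (- \<gamma> * s)" and "\<delta> \<ge> 0"
  shows "continuous_on {..0} (\<lambda>t. recent \<delta> t f)"
proof (unfold continuous_on_sequentially o_def, intro allI ballI impI, elim conjE)
  fix x :: "nat \<Rightarrow> real" and a assume "\<forall>n. x n \<in> {..0}" "x \<longlonglongrightarrow> a"
  then have x: "x n \<le> 0" for n by simp
  obtain B where B: "\<And>n. \<bar>x n\<bar> \<le> B"
    using convergent_imp_Bseq[OF convergentI[OF \<open>x \<longlonglongrightarrow> a\<close>]] by (auto simp: Bseq_def)
  have N: "N \<ge> 0" using f[of 0] norm_ge_zero[of "f 0"] by (simp del: norm_ge_zero)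
  let ?h = "\<lambda>t s. indicator {t<..<0} s *\<^sub>R U (\<delta> * (t - s)) (f s)"
  \<comment> \<open>All the intervals from \<open>x n\<close> to 0 lie in this fixed
    half-line.\<close>
  let ?g = "\<lambda>s. N * (indicator {- B - 1<..} s * exp (- \<gamma> * s))"
  have "(\<lambda>n. \<integral>s. ?h (x n) s \<partial>lborel) \<longlonglongrightarrow> (\<integral>s. ?h a s \<partial>lborel)"
  proof (rule integral_dominated_convergence)
    show "integrable lborel ?g"
      using has_bochner_integral_exp_future[OF pos(1), of "- B - 1"]
      by (auto simp: has_bochner_integral_iff)
    show "AE s in lborel. (\<lambda>n. ?h (x n) s) \<longlonglongrightarrow> ?h a s"
      using AE_lborel_singleton[of a]
    proof eventually_elim
      case (elim s)
      have "(\<lambda>n. indicator {x n<..<0} s :: real) \<longlonglongrightarrow> indicator {a<..<0} s"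
      proof (rule tendsto_eventually)
        from elim consider "s < a" | "s > a" by linarith
        then show "\<forall>\<^sub>F n in sequentially. indicator {x n<..<0} s = (indicator {a<..<0} s :: real)"
        proof cases
          case 1 from order_tendstoD(1)[OF \<open>x \<longlonglongrightarrow> a\<close> this] show ?thesis
            by eventually_elim (use 1 in \<open>auto simp: indicator_def\<close>)
        next
          case 2 from order_tendstoD(2)[OF \<open>x \<longlonglongrightarrow> a\<close> this] show ?thesis
            by eventually_elim (use 2 in \<open>auto simp: indicator_def\<close>)
        qed
      qed
      moreover have "(\<lambda>n. U (\<delta> * (x n - s)) (f s)) \<longlonglongrightarrow> U (\<delta> * (a - s)) (f s)"
        by (intro tendsto_U tendsto_intros \<open>x \<longlonglongrightarrow> a\<close>)
      ultimately show ?case by (rule tendsto_scaleR)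
    qed
    show "AE s in lborel. norm (?h (x n) s) \<le> ?g s" for n
    proof (intro AE_I2)
      fix s
      show "norm (?h (x n) s) \<le> ?g s"
        using order_trans[OF U_bound[of "\<delta> * (x n - s)" "f s"] f[of s]] \<open>\<delta> \<ge> 0\<close> B[of n] N
        by (auto simp: indicator_def mult_nonneg_nonpos)
    qed
  qed measurable
  then show "(\<lambda>n. recent \<delta> (x n) f) \<longlonglongrightarrow> recent \<delta> a f"
    by (simp add: recent_def set_lebesgue_integral_def)
qed

text \<open>The slow system in the fast time \<open>t / \<epsilon>\<close> is the fixed point equation of this operator with
  \<open>\<delta> = \<epsilon>\<close>, and the critical system is the one with \<open>\<delta> = 0\<close>. The value at positive times matches the
  convention of \<^const>\<open>C_fast\<close>.\<close>

definition integral_op ::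
    "real \<Rightarrow> (real \<Rightarrow> 'b) \<Rightarrow> 'a \<Rightarrow> (real \<Rightarrow> 'a \<times> 'b) \<Rightarrow> real \<Rightarrow> 'a \<times> 'b" where
  "integral_op \<delta> z x0 u t =
     (if t \<le> 0
      then (U (\<delta> * t) x0 - \<delta> *\<^sub>R recent \<delta> t (\<lambda>s. g1 (fst (u s), snd (u s) + z s)),
            past t (\<lambda>s. g2 (fst (u s), snd (u s) + z s)))
      else undefined)"

text \<open>One growth class for the noise and for solutions. It asks for measurability instead of
  continuity because the noise is only cadlag, and it bounds the function on the past alone.\<close>

definition tame :: "(real \<Rightarrow> 'c::real_normed_vector) \<Rightarrow> bool" where
  "tame f \<longleftrightarrow> f \<in> borel_measurable borel \<and> (\<exists>N. \<forall>s\<le>0. norm (f s) \<le> N * exp (- \<gamma> * s))"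

text \<open>The component norms are added, as in the Lipschitz condition, so that \<open>K\<close>
  enters the contraction factor without a further constant.\<close>

definition close :: "real \<Rightarrow> (real \<Rightarrow> 'a \<times> 'b) \<Rightarrow> (real \<Rightarrow> 'a \<times> 'b) \<Rightarrow> bool" where
  "close N u v \<longleftrightarrow>
     (\<forall>s\<le>0. norm (fst (u s) - fst (v s)) + norm (snd (u s) - snd (v s)) \<le> N * exp (- \<gamma> * s))"

lemma tame_measurable: "tame f \<Longrightarrow> f \<in> borel_measurable borel"
  by (simp add: tame_def)

lemma tame_measurable_pair:
  fixes u :: "real \<Rightarrow> 'a \<times> 'b"
  shows "tame u \<Longrightarrow> u \<in> borel \<rightarrow>\<^sub>M borel \<Otimes>\<^sub>M borel"
  by (simp add: tame_def borel_prod)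

lemma tame_const: "tame (\<lambda>_. c)"
proof -
  have "norm c \<le> norm c * exp (- \<gamma> * s)" if "s \<le> 0" for s
    using that pos mult_left_mono[of 1 "exp (- \<gamma> * s)" "norm c"]
    by (simp add: mult_nonneg_nonpos)
  then show ?thesis by (auto simp: tame_def)
qed

text \<open>Being Lipschitz and zero at the origin, \<open>g1\<close> and \<open>g2\<close> grow at
  most linearly. The bound contains 2 N because each component of \<open>u\<close> is bounded by the
  norm of \<open>u\<close>.\<close>

lemma tame_nonlinearity:
  assumes "tame u" "tame z"
  shows "tame (\<lambda>s. g1 (fst (u s), snd (u s) + z s))" "tame (\<lambda>s. g2 (fst (u s), snd (u s) + z s))"
proof -
  note [measurable] = tame_measurable_pair[OF assms(1)] tame_measurable[OF assms(2)]
  obtain N where N: "\<And>s. s \<le> 0 \<Longrightarrow> norm (u s) \<le> N * exp (- \<gamma> * s)"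
    using assms(1) by (auto simp: tame_def)
  obtain N' where N': "\<And>s. s \<le> 0 \<Longrightarrow> norm (z s) \<le> N' * exp (- \<gamma> * s)"
    using assms(2) by (auto simp: tame_def)
  have *: "K * (norm (fst (u s) - 0) + norm (snd (u s) + z s - 0))
      \<le> K * (2 * N + N') * exp (- \<gamma> * s)" if "s \<le> 0" for s
  proof -
    have "norm (fst (u s)) + norm (snd (u s) + z s) \<le> (2 * N + N') * exp (- \<gamma> * s)"
      using N[OF that] N'[OF that] norm_fst_le'[of "u s"] norm_snd_le'[of "u s"]
        norm_triangle_ineq[of "snd (u s)" "z s"] by (simp add: algebra_simps)
    then show ?thesis using mult_left_mono[of _ _ K] pos by (simp add: mult.assoc)
  qed
  have "norm (g1 (fst (u s), snd (u s) + z s)) \<le> K * (2 * N + N') * exp (- \<gamma> * s)" if "s \<le> 0" for s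
    using order_trans[OF g1_lip[of _ _ 0 0] *[OF that]] by (simp add: g1_zero)
  moreover have "(\<lambda>s. g1 (fst (u s), snd (u s) + z s)) \<in> borel_measurable borel" by measurable
  ultimately show "tame (\<lambda>s. g1 (fst (u s), snd (u s) + z s))" unfolding tame_def by blast
  have "norm (g2 (fst (u s), snd (u s) + z s)) \<le> K * (2 * N + N') * exp (- \<gamma> * s)" if "s \<le> 0" for s
    using order_trans[OF g2_lip[of _ _ 0 0] *[OF that]] by (simp add: g2_zero)
  moreover have "(\<lambda>s. g2 (fst (u s), snd (u s) + z s)) \<in> borel_measurable borel" by measurable
  ultimately show "tame (\<lambda>s. g2 (fst (u s), snd (u s) + z s))" unfolding tame_def by blast
qed

text \<open>The same noise is added on both sides and drops out of the Lipschitz estimate;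
  \<open>g2\<close> contributes K and the integral 1 / \<kappa>. The bound on the difference is a
  separate premise, so the two components may be estimated by different means.\<close>

lemma past_difference_le:
  assumes "tame u" "tame v" "tame z" "t \<le> 0"
    and uv: "\<And>s. s \<le> 0 \<Longrightarrow> norm (fst (u s) - fst (v s)) + norm (snd (u s) - snd (v s)) \<le> N * exp (- \<gamma> * s)"
  shows "norm (past t (\<lambda>s. g2 (fst (u s), snd (u s) + z s)) - past t (\<lambda>s. g2 (fst (v s), snd (v s) + z s)))
    \<le> K / \<kappa> * N * exp (- \<gamma> * t)"
proof -
  let ?f = "\<lambda>u s. g2 (fst (u s), snd (u s) + z s)"
  note tu = tame_nonlinearity(2)[OF assms(1,3)] and tv = tame_nonlinearity(2)[OF assms(2,3)]
  note [measurable] = tame_measurable[OF tu] tame_measurable[OF tv]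
  have eq: "past t (?f u) - past t (?f v) = past t (\<lambda>s. ?f u s - ?f v s)"
    using tu tv \<open>t \<le> 0\<close> unfolding tame_def by (blast intro: past_diff)
  have "norm (past t (\<lambda>s. ?f u s - ?f v s)) \<le> K * N / \<kappa> * exp (- \<gamma> * t)"
  proof (rule norm_past_le)
    fix s :: real assume s: "s \<le> 0"
    have "norm (?f u s - ?f v s) \<le> K * (norm (fst (u s) - fst (v s)) + norm (snd (u s) - snd (v s)))"
      using g2_lip[of "fst (u s)" "snd (u s) + z s" "fst (v s)" "snd (v s) + z s"] by simp
    also have "\<dots> \<le> K * (N * exp (- \<gamma> * s))" using uv[OF s] pos by (intro mult_left_mono) auto
    finally show "norm (?f u s - ?f v s) \<le> K * N * exp (- \<gamma> * s)" by (simp add: mult.assoc)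
  qed (use \<open>t \<le> 0\<close> in measurable)
  then show ?thesis unfolding eq by simp
qed

lemma recent_difference_le:
  assumes "tame u" "tame v" "tame z" "t \<le> 0" "\<delta> \<ge> 0"
    and uv: "\<And>s. s \<le> 0 \<Longrightarrow> norm (fst (u s) - fst (v s)) + norm (snd (u s) - snd (v s)) \<le> N * exp (- \<gamma> * s)"
  shows "norm (recent \<delta> t (\<lambda>s. g1 (fst (u s), snd (u s) + z s)) - recent \<delta> t (\<lambda>s. g1 (fst (v s), snd (v s) + z s)))
    \<le> K / \<gamma> * N * exp (- \<gamma> * t)"
proof -
  let ?f = "\<lambda>u s. g1 (fst (u s), snd (u s) + z s)"
  note tu = tame_nonlinearity(1)[OF assms(1,3)] and tv = tame_nonlinearity(1)[OF assms(2,3)]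
  note [measurable] = tame_measurable[OF tu] tame_measurable[OF tv]
  have eq: "recent \<delta> t (?f u) - recent \<delta> t (?f v) = recent \<delta> t (\<lambda>s. ?f u s - ?f v s)"
    using tu tv \<open>t \<le> 0\<close> \<open>\<delta> \<ge> 0\<close> unfolding tame_def by (blast intro: recent_diff)
  have "norm (recent \<delta> t (\<lambda>s. ?f u s - ?f v s)) \<le> K * N / \<gamma> * exp (- \<gamma> * t)"
  proof (rule norm_recent_le)
    fix s :: real assume s: "s \<le> 0"
    have "norm (?f u s - ?f v s) \<le> K * (norm (fst (u s) - fst (v s)) + norm (snd (u s) - snd (v s)))"
      using g1_lip[of "fst (u s)" "snd (u s) + z s" "fst (v s)" "snd (v s) + z s"] by simp
    also have "\<dots> \<le> K * (N * exp (- \<gamma> * s))" using uv[OF s] pos by (intro mult_left_mono) auto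
    finally show "norm (?f u s - ?f v s) \<le> K * N * exp (- \<gamma> * s)" by (simp add: mult.assoc)
  qed (use \<open>t \<le> 0\<close> \<open>\<delta> \<ge> 0\<close> in measurable)
  then show ?thesis unfolding eq by simp
qed

text \<open>The Lipschitz constant of \<open>integral_op \<delta>\<close> in the weighted distance:
  the slow component gives the first summand, the fast one the second.\<close>

definition \<rho> :: "real \<Rightarrow> real" where "\<rho> \<delta> = \<delta> * K / \<gamma> + K / \<kappa>"

definition small :: "real \<Rightarrow> bool" where "small \<delta> \<longleftrightarrow> 0 \<le> \<delta> \<and> \<rho> \<delta> < 1"

lemma small: "small \<delta> \<Longrightarrow> \<delta> \<ge> 0" "small \<delta> \<Longrightarrow> \<rho> \<delta> \<ge> 0" "small \<delta> \<Longrightarrow> \<rho> \<delta> < 1"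
  using pos \<kappa> by (auto simp: small_def \<rho>_def intro!: add_nonneg_nonneg divide_nonneg_nonneg)

lemma small_zero: "small 0"
  using \<kappa> by (simp add: small_def \<rho>_def)

lemma eventually_small: "\<forall>\<^sub>F \<epsilon> in at_right 0. small \<epsilon>"
proof -
  have "((\<lambda>\<epsilon>. \<rho> \<epsilon>) \<longlongrightarrow> 0 * K / \<gamma> + K / \<kappa>) (at_right 0)"
    unfolding \<rho>_def by (intro tendsto_intros) (use pos in auto)
  then have "\<forall>\<^sub>F \<epsilon> in at_right 0. \<rho> \<epsilon> < 1" by (rule order_tendstoD) (use \<kappa> in simp)
  moreover have "\<forall>\<^sub>F \<epsilon> in at_right (0::real). \<epsilon> > 0" by (rule eventually_at_right_less)
  ultimately show ?thesis by eventually_elim (simp add: small_def)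
qed

lemma close_integral_op:
  assumes "tame u" "tame v" "tame z" "\<delta> \<ge> 0" "close N u v"
  shows "close (\<rho> \<delta> * N) (integral_op \<delta> z x0 u) (integral_op \<delta> z x0 v)"
  unfolding close_def
proof (intro allI impI)
  fix t :: real assume t: "t \<le> 0"
  note uv = assms(5)[unfolded close_def, rule_format]
  let ?r = "\<lambda>u. recent \<delta> t (\<lambda>s. g1 (fst (u s), snd (u s) + z s))"
  let ?p = "\<lambda>u. past t (\<lambda>s. g2 (fst (u s), snd (u s) + z s))"
  have "norm (\<delta> *\<^sub>R ?r v - \<delta> *\<^sub>R ?r u) = \<delta> * norm (?r u - ?r v)"
    using \<open>\<delta> \<ge> 0\<close> by (simp add: scaleR_diff_right[symmetric] norm_minus_commute)
  also have "\<dots> \<le> \<delta> * (K / \<gamma> * N * exp (- \<gamma> * t))"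
    by (intro mult_left_mono recent_difference_le assms t uv)
  finally have "norm (\<delta> *\<^sub>R ?r v - \<delta> *\<^sub>R ?r u) \<le> \<delta> * (K / \<gamma> * N * exp (- \<gamma> * t))" .
  moreover have "norm (?p u - ?p v) \<le> K / \<kappa> * N * exp (- \<gamma> * t)"
    by (intro past_difference_le assms t uv)
  ultimately have "norm (\<delta> *\<^sub>R ?r v - \<delta> *\<^sub>R ?r u) + norm (?p u - ?p v) \<le> \<rho> \<delta> * N * exp (- \<gamma> * t)"
    by (simp add: \<rho>_def algebra_simps)
  then show "norm (fst (integral_op \<delta> z x0 u t) - fst (integral_op \<delta> z x0 v t))
      + norm (snd (integral_op \<delta> z x0 u t) - snd (integral_op \<delta> z x0 v t)) \<le> \<rho> \<delta> * N * exp (- \<gamma> * t)"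
    using t by (simp add: integral_op_def)
qed

text \<open>Only values on the past enter the integrals. This lets functions that are
  \<open>undefined\<close> at positive times be exchanged for the fixed point, which may take
  another value there.\<close>

lemma integral_op_cong:
  assumes "\<And>s. s \<le> 0 \<Longrightarrow> u s = v s"
  shows "integral_op \<delta> z x0 u t = integral_op \<delta> z x0 v t"
  unfolding integral_op_def recent_def past_def set_lebesgue_integral_def
  by (auto simp: assms indicator_def intro!: Bochner_Integration.integral_cong arg_cong[of _ _ "scaleR \<delta>"])

text \<open>Parametric integrals of jointly measurable functions are measurable in the parameter.
  Joint measurability in time and path is the form that can be iterated, since the next step
  integrates over time again.\<close>

lemma measurable_integral_op:
  assumes [measurable]: "(\<lambda>(s, w). u s w) \<in> borel_measurable (borel \<Otimes>\<^sub>M M)"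
      "(\<lambda>(s, w). z s w) \<in> borel_measurable (borel \<Otimes>\<^sub>M M)"
  shows "(\<lambda>(t, w). integral_op \<delta> (\<lambda>s. z s w) x0 (\<lambda>s. u s w) t) \<in> borel_measurable (borel \<Otimes>\<^sub>M M)"
proof -
  define a b where "a s w = fst (u s w)" and "b s w = snd (u s w)" for s w
  have "(\<lambda>x. fst (case_prod u x)) \<in> borel_measurable (borel \<Otimes>\<^sub>M M)"
    "(\<lambda>x. snd (case_prod u x)) \<in> borel_measurable (borel \<Otimes>\<^sub>M M)"
    using assms(1) unfolding borel_prod[symmetric]
    by (rule measurable_compose, measurable)+
  then have [measurable]: "(\<lambda>(s, w). a s w) \<in> borel_measurable (borel \<Otimes>\<^sub>M M)"
    "(\<lambda>(s, w). b s w) \<in> borel_measurable (borel \<Otimes>\<^sub>M M)"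
    by (simp_all add: a_def b_def split_beta)
  \<comment> \<open>The endpoint t varies together with the path, so the indicators have to be read
    as comparisons that are measurable in s and t jointly.\<close>
  have ind: "indicator {..<t} s = (if s < t then 1 else (0::real))"
    "indicator {t<..<0} s = (if t < s \<and> s < 0 then 1 else (0::real))" for s t :: real
    by auto
  have "(\<lambda>x. \<integral>s. (if fst x < s \<and> s < 0 then 1 else 0) *\<^sub>R
        U (\<delta> * (fst x - s)) (g1 (a s (snd x), b s (snd x) + z s (snd x))) \<partial>lborel)
      \<in> borel_measurable (borel \<Otimes>\<^sub>M M)"
    by measurable
  moreover have "(\<lambda>x. \<integral>s. (if s < fst x then 1 else 0) *\<^sub>R
        V (fst x - s) (g2 (a s (snd x), b s (snd x) + z s (snd x))) \<partial>lborel)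
      \<in> borel_measurable (borel \<Otimes>\<^sub>M M)"
    by measurable
  ultimately show ?thesis
    unfolding integral_op_def past_def recent_def set_lebesgue_integral_def ind split_beta
      a_def[symmetric] b_def[symmetric]
    by (intro measurable_If borel_measurable_Pair borel_measurable_diff borel_measurable_scaleR
        U_measurable borel_measurable_const borel_measurable_times) measurable
qed

text \<open>The joint statement with a dummy real parameter in place of the path.\<close>

lemma integral_op_measurable:
  assumes "tame u" "tame z"
  shows "integral_op \<delta> z x0 u \<in> borel_measurable borel"
proof -
  note [measurable] = tame_measurable_pair[OF assms(1)] tame_measurable[OF assms(2)]
  have "(\<lambda>(s, w::real). u s) \<in> borel \<Otimes>\<^sub>M borel \<rightarrow>\<^sub>M borel \<Otimes>\<^sub>M borel"
    "(\<lambda>(s, w::real). z s) \<in> borel_measurable (borel \<Otimes>\<^sub>M borel)"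
    by measurable
  then have "(\<lambda>(t, w::real). integral_op \<delta> z x0 u t) \<in> borel_measurable (borel \<Otimes>\<^sub>M borel)"
    by (intro measurable_integral_op) (simp_all add: borel_prod)
  from measurable_compose[OF _ this, of "\<lambda>t. (t, 0)"] show ?thesis by simp
qed

lemma tame_integral_op:
  assumes "tame u" "tame z" "\<delta> \<ge> 0"
  shows "tame (integral_op \<delta> z x0 u)"
proof -
  let ?f = "\<lambda>s. g1 (fst (u s), snd (u s) + z s)" and ?g = "\<lambda>s. g2 (fst (u s), snd (u s) + z s)"
  note tame = tame_nonlinearity[OF assms(1,2)]
  note [measurable] = tame_measurable[OF tame(1)] tame_measurable[OF tame(2)]
  obtain N where N: "\<And>s. s \<le> 0 \<Longrightarrow> norm (?f s) \<le> N * exp (- \<gamma> * s)"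
    using tame(1) by (auto simp: tame_def)
  obtain N' where N': "\<And>s. s \<le> 0 \<Longrightarrow> norm (?g s) \<le> N' * exp (- \<gamma> * s)"
    using tame(2) by (auto simp: tame_def)
  have "norm (integral_op \<delta> z x0 u t) \<le> (norm x0 + \<delta> * (N / \<gamma>) + N' / \<kappa>) * exp (- \<gamma> * t)"
    if t: "t \<le> 0" for t
  proof -
    have "norm (integral_op \<delta> z x0 u t) \<le> norm (U (\<delta> * t) x0 - \<delta> *\<^sub>R recent \<delta> t ?f) + norm (past t ?g)"
      using t by (simp add: integral_op_def norm_Pair_le)
    also have "\<dots> \<le> norm (U (\<delta> * t) x0) + norm (\<delta> *\<^sub>R recent \<delta> t ?f) + norm (past t ?g)"
      by (intro add_right_mono norm_triangle_ineq4)
    also have "\<dots> \<le> norm x0 * exp (- \<gamma> * t) + \<delta> * (N / \<gamma> * exp (- \<gamma> * t)) + N' / \<kappa> * exp (- \<gamma> * t)"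
    proof (intro add_mono)
      have "norm (U (\<delta> * t) x0) \<le> norm x0 * 1"
        using U_bound[of "\<delta> * t" x0] t \<open>\<delta> \<ge> 0\<close> by (simp add: mult_nonneg_nonpos)
      also have "\<dots> \<le> norm x0 * exp (- \<gamma> * t)"
        using t pos by (intro mult_left_mono) (auto simp: mult_nonneg_nonpos)
      finally show "norm (U (\<delta> * t) x0) \<le> norm x0 * exp (- \<gamma> * t)" .
      show "norm (\<delta> *\<^sub>R recent \<delta> t ?f) \<le> \<delta> * (N / \<gamma> * exp (- \<gamma> * t))"
        using mult_left_mono[OF norm_recent_le[OF _ N t \<open>\<delta> \<ge> 0\<close>] \<open>\<delta> \<ge> 0\<close>] \<open>\<delta> \<ge> 0\<close> by simp
      show "norm (past t ?g) \<le> N' / \<kappa> * exp (- \<gamma> * t)"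
        using norm_past_le[OF _ N' t] by simp
    qed
    finally show ?thesis by (simp add: algebra_simps)
  qed
  then show ?thesis unfolding tame_def using integral_op_measurable[OF assms(1,2)] by blast
qed

lemma continuous_on_integral_op:
  assumes "tame u" "tame z" "\<delta> \<ge> 0"
  shows "continuous_on {..0} (integral_op \<delta> z x0 u)"
proof -
  let ?f = "\<lambda>s. g1 (fst (u s), snd (u s) + z s)" and ?g = "\<lambda>s. g2 (fst (u s), snd (u s) + z s)"
  note tame = tame_nonlinearity[OF assms(1,2)]
  have p: "continuous_on {..0} (\<lambda>t. past t ?g)"
    using tame(2) unfolding tame_def by (blast intro: continuous_on_past)
  have r: "continuous_on {..0} (\<lambda>t. recent \<delta> t ?f)"
    using tame(1) \<open>\<delta> \<ge> 0\<close> unfolding tame_def by (blast intro: continuous_on_recent)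
  have "continuous_on {..0} (\<lambda>t. (U (\<delta> * t) x0 - \<delta> *\<^sub>R recent \<delta> t ?f, past t ?g))"
    by (intro continuous_intros p r continuous_on_compose2[OF U_cont, of _ "\<lambda>t. (\<delta> * t, x0)", simplified])
  then show ?thesis
    by (rule continuous_on_eq) (simp add: integral_op_def)
qed

section \<open>Picard iteration: existence and uniqueness\<close>

definition picard :: "real \<Rightarrow> (real \<Rightarrow> 'b) \<Rightarrow> 'a \<Rightarrow> nat \<Rightarrow> real \<Rightarrow> 'a \<times> 'b" where
  "picard \<delta> z x0 k = (integral_op \<delta> z x0 ^^ k) (\<lambda>_. 0)"

lemma picard_simps [simp]:
  "picard \<delta> z x0 0 = (\<lambda>_. 0)" "picard \<delta> z x0 (Suc k) = integral_op \<delta> z x0 (picard \<delta> z x0 k)"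
  by (simp_all add: picard_def)

text \<open>A pointwise limit of iterates that start from the same function for every noise, so that
  measurability in the path passes to the solution.\<close>

definition fixpoint :: "real \<Rightarrow> (real \<Rightarrow> 'b) \<Rightarrow> 'a \<Rightarrow> real \<Rightarrow> 'a \<times> 'b" where
  "fixpoint \<delta> z x0 t = lim (\<lambda>k. picard \<delta> z x0 k t)"

lemma tame_picard: "tame z \<Longrightarrow> \<delta> \<ge> 0 \<Longrightarrow> tame (picard \<delta> z x0 k)"
  by (induction k) (auto simp del: zero_prod_def intro: tame_const tame_integral_op)

lemma close_trans:
  assumes "close N u v" "close N' v w"
  shows "close (N + N') u w"
  unfolding close_def
proof (intro allI impI)
  fix s :: real assume s: "s \<le> 0"
  have "norm (fst (u s) - fst (w s)) \<le> norm (fst (u s) - fst (v s)) + norm (fst (v s) - fst (w s))"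
    "norm (snd (u s) - snd (w s)) \<le> norm (snd (u s) - snd (v s)) + norm (snd (v s) - snd (w s))"
    using norm_triangle_ineq[of "fst (u s) - fst (v s)" "fst (v s) - fst (w s)"]
      norm_triangle_ineq[of "snd (u s) - snd (v s)" "snd (v s) - snd (w s)"] by simp_all
  then show "norm (fst (u s) - fst (w s)) + norm (snd (u s) - snd (w s)) \<le> (N + N') * exp (- \<gamma> * s)"
    using assms[unfolded close_def, rule_format, OF s] by (simp add: algebra_simps)
qed

lemma tame_close:
  assumes "tame u" "tame v"
  obtains N where "close N u v"
proof -
  obtain N where N: "\<And>s. s \<le> 0 \<Longrightarrow> norm (u s) \<le> N * exp (- \<gamma> * s)"
    using assms(1) by (auto simp: tame_def)
  obtain N' where N': "\<And>s. s \<le> 0 \<Longrightarrow> norm (v s) \<le> N' * exp (- \<gamma> * s)"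
    using assms(2) by (auto simp: tame_def)
  have "close (2 * (N + N')) u v"
    unfolding close_def
  proof (intro allI impI)
    fix s :: real assume s: "s \<le> 0"
    have "norm (fst (u s) - fst (v s)) \<le> norm (u s - v s)" "norm (snd (u s) - snd (v s)) \<le> norm (u s - v s)"
      using norm_fst_le'[of "u s - v s"] norm_snd_le'[of "u s - v s"] by simp_all
    then show "norm (fst (u s) - fst (v s)) + norm (snd (u s) - snd (v s)) \<le> 2 * (N + N') * exp (- \<gamma> * s)"
      using N[OF s] N'[OF s] norm_triangle_ineq4[of "u s" "v s"] by (simp add: algebra_simps)
  qed
  then show ?thesis by (rule that)
qed

lemma norm_le_if_close:
  assumes "close N u v" "s \<le> 0"
  shows "norm (u s - v s) \<le> N * exp (- \<gamma> * s)"
proof -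
  have "norm (u s - v s) = norm (fst (u s) - fst (v s), snd (u s) - snd (v s))"
    by (simp add: prod_eq_iff flip: minus_prod_def)
  also have "\<dots> \<le> norm (fst (u s) - fst (v s)) + norm (snd (u s) - snd (v s))"
    by (rule norm_Pair_le)
  finally show ?thesis using assms by (force simp: close_def)
qed

text \<open>Consecutive iterates differ by at most N \<rho>^k in the weighted distance. Summing the
  geometric series gives a bound uniform in j, which therefore survives the limit in j.\<close>

lemma picard_close:
  assumes "tame z" "small \<delta>"
  obtains N where "N \<ge> 0" "\<And>k j. close (N * \<rho> \<delta> ^ k) (picard \<delta> z x0 (k + j)) (picard \<delta> z x0 k)"
proof -
  note sm = small[OF assms(2)]
  let ?p = "picard \<delta> z x0" and ?r = "\<rho> \<delta>"
  obtain N where N: "close N (?p 1) (?p 0)"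
    by (rule tame_close[OF tame_picard[OF assms(1) sm(1)] tame_picard[OF assms(1) sm(1)]])
  have N0: "N \<ge> 0"
    using norm_le_if_close[OF N, of 0] order_trans[OF norm_ge_zero] by fastforce
  have step: "close (N * ?r ^ k) (?p (Suc k)) (?p k)" for k
  proof (induction k)
    case 0
    then show ?case using N by simp
  next
    case (Suc k)
    from close_integral_op[OF tame_picard tame_picard assms(1) sm(1) Suc, of x0] show ?case
      using assms(1) sm(1) by (simp add: algebra_simps)
  qed
  have geo: "close (N * ?r ^ k * (\<Sum>i<j. ?r ^ i)) (?p (k + j)) (?p k)" for k j
  proof (induction j)
    case 0
    then show ?case by (simp add: close_def)
  next
    case (Suc j)
    have "N * ?r ^ (k + j) + N * ?r ^ k * (\<Sum>i<j. ?r ^ i) = N * ?r ^ k * (\<Sum>i<Suc j. ?r ^ i)"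
      by (simp add: power_add algebra_simps)
    with close_trans[OF step[of "k + j"] Suc] show ?case by simp
  qed
  have "close (N / (1 - ?r) * ?r ^ k) (?p (k + j)) (?p k)" for k j
  proof -
    have "(\<Sum>i<j. ?r ^ i) \<le> 1 / (1 - ?r)"
      using sm by (simp add: sum_gp_strict divide_right_mono)
    from mult_left_mono[OF this, of "N * ?r ^ k"]
    have "N * ?r ^ k * (\<Sum>i<j. ?r ^ i) \<le> N / (1 - ?r) * ?r ^ k"
      using N0 sm(2) by simp
    then have "N * ?r ^ k * (\<Sum>i<j. ?r ^ i) * exp (- \<gamma> * s) \<le> N / (1 - ?r) * ?r ^ k * exp (- \<gamma> * s)" for s
      by (rule mult_right_mono) simp
    with geo[of k j] show ?thesis unfolding close_def by (meson order_trans)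
  qed
  then show ?thesis using that[of "N / (1 - ?r)"] N0 sm by simp
qed

lemma picard_tendsto:
  assumes "tame z" "small \<delta>"
  shows "(\<lambda>k. picard \<delta> z x0 k t) \<longlonglongrightarrow> fixpoint \<delta> z x0 t"
proof -
  let ?p = "picard \<delta> z x0" and ?r = "\<rho> \<delta>"
  have "convergent (\<lambda>k. ?p k t)"
  proof (cases "t \<le> 0")
    case True
    obtain N where N: "N \<ge> 0" "\<And>k j. close (N * ?r ^ k) (?p (k + j)) (?p k)"
      by (rule picard_close[OF assms, of x0]) blast
    have le: "norm (?p (k + j) t - ?p k t) \<le> N * ?r ^ k * exp (- \<gamma> * t)" for k j
      using norm_le_if_close[OF N(2) True] .
    have lim: "(\<lambda>k. N * ?r ^ k * exp (- \<gamma> * t)) \<longlonglongrightarrow> N * 0 * exp (- \<gamma> * t)"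
      using small(2,3)[OF assms(2)] by (intro tendsto_intros LIMSEQ_realpow_zero)
    have "Cauchy (\<lambda>k. ?p k t)"
    proof (rule CauchyI')
      fix e :: real assume "e > 0"
      with order_tendstoD(2)[OF lim, of e] obtain n where
        n: "\<And>k. k \<ge> n \<Longrightarrow> N * ?r ^ k * exp (- \<gamma> * t) < e"
        by (auto simp: eventually_sequentially)
      have "norm (?p k t - ?p m t) < e" if "k \<ge> n" "m > k" for k m
        using le[of k "m - k"] n[OF that(1)] that(2) by (simp add: norm_minus_commute)
      then show "\<exists>M. \<forall>m\<ge>M. \<forall>n>m. dist (?p m t) (?p n t) < e"
        unfolding dist_norm by blast
    qed
    then show ?thesis by (rule Cauchy_convergent)
  next
    case False
    \<comment> \<open>At positive times every iterate after the initial zero is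
      \<open>undefined\<close>, so the sequence converges there as well.\<close>
    then have "(\<lambda>k. ?p (Suc k) t) = (\<lambda>k. undefined)" by (simp add: integral_op_def)
    then show ?thesis using convergent_Suc_iff[of "\<lambda>k. ?p k t"] convergent_const by metis
  qed
  then show ?thesis unfolding fixpoint_def convergent_LIMSEQ_iff .
qed

text \<open>The limit j -> \<infinity> in \<open>picard_close\<close>. The case k = 0 shows that the
  limit is tame, large k that it is a fixed point.\<close>

lemma fixpoint_close:
  assumes "tame z" "small \<delta>"
  obtains N where "N \<ge> 0" "\<And>k. close (N * \<rho> \<delta> ^ k) (fixpoint \<delta> z x0) (picard \<delta> z x0 k)"
proof -
  let ?p = "picard \<delta> z x0" and ?r = "\<rho> \<delta>"
  obtain N where N: "N \<ge> 0" "\<And>k j. close (N * ?r ^ k) (?p (k + j)) (?p k)"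
    by (rule picard_close[OF assms, of x0]) blast
  have "close (N * ?r ^ k) (fixpoint \<delta> z x0) (?p k)" for k
    unfolding close_def
  proof (intro allI impI)
    fix s :: real assume s: "s \<le> 0"
    have "(\<lambda>j. ?p (k + j) s) \<longlonglongrightarrow> fixpoint \<delta> z x0 s"
      using LIMSEQ_ignore_initial_segment[OF picard_tendsto[OF assms, of x0 s], of k] by (simp add: add.commute)
    then have "(\<lambda>j. norm (fst (?p (k + j) s) - fst (?p k s)) + norm (snd (?p (k + j) s) - snd (?p k s)))
      \<longlonglongrightarrow> norm (fst (fixpoint \<delta> z x0 s) - fst (?p k s)) + norm (snd (fixpoint \<delta> z x0 s) - snd (?p k s))"
      by (intro tendsto_intros)
    then show "norm (fst (fixpoint \<delta> z x0 s) - fst (?p k s)) + norm (snd (fixpoint \<delta> z x0 s) - snd (?p k s))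
        \<le> N * ?r ^ k * exp (- \<gamma> * s)"
      by (rule LIMSEQ_le_const2) (use N(2)[of k] s in \<open>auto simp: close_def\<close>)
  qed
  then show ?thesis using that N(1) by blast
qed

lemma tame_fixpoint:
  assumes "tame z" "small \<delta>"
  shows "tame (fixpoint \<delta> z x0)"
proof -
  obtain N where N: "\<And>k. close (N * \<rho> \<delta> ^ k) (fixpoint \<delta> z x0) (picard \<delta> z x0 k)"
    by (rule fixpoint_close[OF assms, of x0]) blast
  have "norm (fixpoint \<delta> z x0 s) \<le> N * exp (- \<gamma> * s)" if "s \<le> 0" for s
    using norm_le_if_close[OF N[of 0] that] by simp
  moreover have "fixpoint \<delta> z x0 \<in> borel_measurable borel"
    by (rule borel_measurable_LIMSEQ_metric[OF _ picard_tendsto[OF assms]])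
      (rule tame_measurable[OF tame_picard[OF assms(1) small(1)[OF assms(2)]]])
  ultimately show ?thesis unfolding tame_def by blast
qed

text \<open>The contraction estimate carries the operator through the limit. The equation holds
  between functions: at positive times both sides are \<open>undefined\<close>.\<close>

lemma fixpoint_eq:
  assumes "tame z" "small \<delta>"
  shows "fixpoint \<delta> z x0 = integral_op \<delta> z x0 (fixpoint \<delta> z x0)"
proof
  fix t
  let ?p = "picard \<delta> z x0" and ?r = "\<rho> \<delta>" and ?u = "fixpoint \<delta> z x0"
  note lim = LIMSEQ_Suc[OF picard_tendsto[OF assms, of x0 t]]
  have "(\<lambda>k. ?p (Suc k) t) \<longlonglongrightarrow> integral_op \<delta> z x0 ?u t"
  proof (cases "t \<le> 0")
    case True
    obtain N where N: "\<And>k. close (N * ?r ^ k) ?u (?p k)"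
      by (rule fixpoint_close[OF assms, of x0]) blast
    have le: "norm (integral_op \<delta> z x0 ?u t - ?p (Suc k) t) \<le> ?r * (N * ?r ^ k) * exp (- \<gamma> * t)" for k
      using norm_le_if_close[OF close_integral_op[OF tame_fixpoint[OF assms] tame_picard assms(1) _ N] True]
        small(1)[OF assms(2)] assms(1) by simp
    have "(\<lambda>k. ?r * (N * ?r ^ k) * exp (- \<gamma> * t)) \<longlonglongrightarrow> ?r * (N * 0) * exp (- \<gamma> * t)"
      using small(2,3)[OF assms(2)] by (intro tendsto_intros LIMSEQ_realpow_zero)
    then have "(\<lambda>k. ?r * (N * ?r ^ k) * exp (- \<gamma> * t)) \<longlonglongrightarrow> 0" by simp
    from Lim_null_comparison[OF _ this, of "\<lambda>k. integral_op \<delta> z x0 ?u t - ?p (Suc k) t"] le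
    have "(\<lambda>k. integral_op \<delta> z x0 ?u t - ?p (Suc k) t) \<longlonglongrightarrow> 0" by (simp del: picard_simps)
    from tendsto_diff[OF tendsto_const[of "integral_op \<delta> z x0 ?u t"] this] show ?thesis by simp
  next
    case False
    then show ?thesis by (simp add: integral_op_def)
  qed
  with lim show "?u t = integral_op \<delta> z x0 ?u t" by (rule LIMSEQ_unique)
qed

text \<open>Two tame solutions have some finite weighted distance, and the iteration with a = 0
  reduces it to 0.\<close>

lemma fixpoint_unique:
  assumes "tame z" "small \<delta>" "tame u"
    and u: "\<And>t. t \<le> 0 \<Longrightarrow> u t = integral_op \<delta> z x0 u t" and "t \<le> 0"
  shows "u t = fixpoint \<delta> z x0 t"
proof -
  let ?v = "fixpoint \<delta> z x0"
  let ?e = "\<lambda>s. norm (fst (u s) - fst (?v s)) + norm (snd (u s) - snd (?v s))"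
  note sm = small[OF assms(2)] and tv = tame_fixpoint[OF assms(1,2), of x0]
  obtain N where N: "close N u ?v" by (rule tame_close[OF assms(3) tv])
  have "?e t \<le> 0 / (1 - \<rho> \<delta>) * exp (- \<gamma> * t)"
  proof (rule weighted_contraction_bound[where e = ?e, OF sm(2,3) _ _ \<open>t \<le> 0\<close>])
    show "?e s \<le> N * exp (- \<gamma> * s)" if "s \<le> 0" for s using N that by (auto simp: close_def)
    fix N s assume "\<And>s. s \<le> 0 \<Longrightarrow> ?e s \<le> N * exp (- \<gamma> * s)" and s: "s \<le> (0::real)"
    then have "close N u ?v" by (simp add: close_def)
    from close_integral_op[OF assms(3) tv assms(1) sm(1) this, of x0]
    show "?e s \<le> (0 + \<rho> \<delta> * N) * exp (- \<gamma> * s)"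
      using s u[OF s] fixpoint_eq[OF assms(1,2), of x0] by (simp add: close_def)
  qed
  then have "norm (fst (u t) - fst (?v t)) \<le> 0" "norm (snd (u t) - snd (?v t)) \<le> 0"
    using norm_ge_zero[of "fst (u t) - fst (?v t)"] norm_ge_zero[of "snd (u t) - snd (?v t)"]
    by linarith+
  then show ?thesis by (simp add: prod_eq_iff)
qed

section \<open>Measurable dependence on the path\<close>

lemma measurable_picard:
  assumes [measurable]: "(\<lambda>(s, w). z s w) \<in> borel_measurable (borel \<Otimes>\<^sub>M M)"
  shows "(\<lambda>(t, w). picard \<delta> (\<lambda>s. z s w) x0 k t) \<in> borel_measurable (borel \<Otimes>\<^sub>M M)"
  by (induction k) (auto simp del: zero_prod_def intro: measurable_integral_op assms)

lemma measurable_fixpoint: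
  assumes "(\<lambda>(s, w). z s w) \<in> borel_measurable (borel \<Otimes>\<^sub>M M)"
    and "\<And>w. w \<in> space M \<Longrightarrow> tame (\<lambda>s. z s w)" "small \<delta>"
  shows "(\<lambda>w. fixpoint \<delta> (\<lambda>s. z s w) x0 t) \<in> borel_measurable M"
proof (rule borel_measurable_LIMSEQ_metric[OF _ picard_tendsto])
  show "(\<lambda>w. picard \<delta> (\<lambda>s. z s w) x0 k t) \<in> borel_measurable M" for k
    using measurable_compose[OF _ measurable_picard[OF assms(1)], of "\<lambda>w. (t, w)" M] by simp
qed (use assms in auto)

section \<open>Distance to the critical solution\<close>

lemma fst_fixpoint_zero:
  assumes "tame z" "t \<le> 0"
  shows "fst (fixpoint 0 z x0 t) = x0"
  \<comment> \<open>The displacement bound at time 0 says that \<open>U 0 x0 = x0\<close>; with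
    \<delta> = 0 the slow component stays there.\<close>
  using fun_cong[OF fixpoint_eq[OF assms(1) small_zero, of x0], of t] assms(2) U_near[of 0 x0]
  by (simp add: integral_op_def)

text \<open>The slow component leaves x0 by at most \<delta> M e^(-\<gamma> t). Inserted into the
  fast equation this turns a bound N for the fast components into K / \<kappa> (\<delta> M + N), and
  iteration leads to the stated constant, which depends on x0 but neither on z nor on
  \<delta>.\<close>

lemma fixpoint_near_critical:
  assumes "tame z" "small \<delta>"
  shows "norm (snd (fixpoint \<delta> z x0 0) - snd (fixpoint 0 z x0 0))
    \<le> (K / \<kappa>) * ((D * norm x0 + C) / \<gamma>) / (1 - K / \<kappa>) * \<delta>"
proof -
  let ?u = "fixpoint \<delta> z x0" and ?v = "fixpoint 0 z x0"
  \<comment> \<open>D accounts for the linear flow and C for the integral of \<open>g1\<close>; the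
    division by \<gamma> comes from |t| \<le> e^(-\<gamma> t) / \<gamma> for t \<le> 0.\<close>
  define M where "M = (D * norm x0 + C) / \<gamma>"
  have \<delta>: "\<delta> \<ge> 0" by (rule small(1)[OF assms(2)])
  note tu = tame_fixpoint[OF assms, of x0] and tv = tame_fixpoint[OF assms(1) small_zero, of x0]
  note equ = fixpoint_eq[OF assms, of x0] and eqv = fixpoint_eq[OF assms(1) small_zero, of x0]
  have x: "norm (fst (?u t) - fst (?v t)) \<le> \<delta> * M * exp (- \<gamma> * t)" if t: "t \<le> 0" for t
  proof -
    let ?f = "\<lambda>s. g1 (fst (?u s), snd (?u s) + z s)"
    have "fst (?u t) = U (\<delta> * t) x0 - \<delta> *\<^sub>R recent \<delta> t ?f"
      using fun_cong[OF equ, of t] t by (simp add: integral_op_def)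
    then have "norm (fst (?u t) - fst (?v t)) = norm ((U (\<delta> * t) x0 - x0) - \<delta> *\<^sub>R recent \<delta> t ?f)"
      using fst_fixpoint_zero[OF assms(1) t] by (simp add: diff_diff_eq add.commute)
    also have "\<dots> \<le> norm (U (\<delta> * t) x0 - x0) + norm (\<delta> *\<^sub>R recent \<delta> t ?f)"
      by (rule norm_triangle_ineq4)
    also have "\<dots> \<le> D * \<bar>\<delta> * t\<bar> * norm x0 + \<delta> * (C * \<bar>t\<bar>)"
    proof (rule add_mono)
      show "norm (U (\<delta> * t) x0 - x0) \<le> D * \<bar>\<delta> * t\<bar> * norm x0"
        using t \<delta> by (intro U_near) (simp add: mult_nonneg_nonpos)
      have "norm (recent \<delta> t ?f) \<le> C * \<bar>t\<bar>"
        by (rule norm_recent_le_linear[OF tame_measurable[OF tame_nonlinearity(1)[OF tu assms(1)]]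
              g1_bound t \<delta>])
      from mult_left_mono[OF this \<delta>] show "norm (\<delta> *\<^sub>R recent \<delta> t ?f) \<le> \<delta> * (C * \<bar>t\<bar>)"
        using \<delta> by simp
    qed
    also have "\<dots> = \<delta> * M * (\<gamma> * \<bar>t\<bar>)"
      using \<delta> pos by (simp add: M_def abs_mult field_simps)
    also have "\<dots> \<le> \<delta> * M * exp (- \<gamma> * t)"
    proof (rule mult_left_mono)
      show "\<gamma> * \<bar>t\<bar> \<le> exp (- \<gamma> * t)"
        using exp_ge_add_one_self[of "- \<gamma> * t"] t by simp
      show "0 \<le> \<delta> * M" using \<delta> pos C_nonneg by (simp add: M_def)
    qed
    finally show ?thesis .
  qed
  let ?e = "\<lambda>s. norm (snd (?u s) - snd (?v s))"
  obtain N where N: "close N ?u ?v" by (rule tame_close[OF tu tv])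
  have "?e 0 \<le> (K / \<kappa> * (\<delta> * M)) / (1 - K / \<kappa>) * exp (- \<gamma> * 0)"
  proof (rule weighted_contraction_bound[where e = ?e and \<rho> = "K / \<kappa>" and N = N])
    show "?e s \<le> N * exp (- \<gamma> * s)" if "s \<le> 0" for s
      using N that by (auto simp: close_def intro: order_trans[rotated])
    fix N s assume IH: "\<And>s. s \<le> 0 \<Longrightarrow> ?e s \<le> N * exp (- \<gamma> * s)" and s: "s \<le> (0::real)"
    have "norm (fst (?u s) - fst (?v s)) + ?e s \<le> (\<delta> * M + N) * exp (- \<gamma> * s)" if "s \<le> 0" for s
      using x[OF that] IH[OF that] by (simp add: algebra_simps)
    from past_difference_le[OF tu tv assms(1) s this]
    show "?e s \<le> (K / \<kappa> * (\<delta> * M) + K / \<kappa> * N) * exp (- \<gamma> * s)"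
      using s fun_cong[OF equ, of s] fun_cong[OF eqv, of s] by (simp add: integral_op_def algebra_simps add_divide_distrib)
  qed (use \<kappa> in auto)
  then show ?thesis by (simp add: M_def algebra_simps)
qed

section \<open>Passage between the original time and the fast time\<close>

lemma tame_if_C_fast:
  assumes "\<phi> \<in> C_fast (- \<gamma> / \<epsilon>)" "\<epsilon> > 0"
  shows "tame (\<lambda>r. \<phi> (\<epsilon> * r))"
  unfolding tame_def
proof
  have ext: "\<phi> t = undefined" if "\<not> t \<le> 0" for t
    using assms(1) that by (auto simp: C_fast_def extensional_def)
  have cont: "continuous_on {..0} \<phi>" using assms(1) by (simp add: C_fast_def)
  have "(\<lambda>t. if t \<in> {..0} then \<phi> t else undefined) \<in> borel_measurable borel"
    by (intro borel_measurable_continuous_on_if cont continuous_on_const) simp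
  also have "(\<lambda>t. if t \<in> {..0} then \<phi> t else undefined) = \<phi>" using ext by auto
  finally have "\<phi> \<in> borel_measurable borel" .
  from measurable_compose[OF _ this, of "\<lambda>r. \<epsilon> * r"]
  show "(\<lambda>r. \<phi> (\<epsilon> * r)) \<in> borel_measurable borel" by simp
  obtain N where N: "\<And>t. t \<le> 0 \<Longrightarrow> exp (\<gamma> / \<epsilon> * t) * norm (\<phi> t) \<le> N"
    using assms(1) by (auto simp: C_fast_def bdd_above_def)
  have "norm (\<phi> (\<epsilon> * r)) \<le> N * exp (- \<gamma> * r)" if "r \<le> 0" for r
  proof -
    \<comment> \<open>At time \<epsilon> r the weight with exponent -\<gamma> / \<epsilon> becomes
      the weight with exponent -\<gamma> at r.\<close>
    have "exp (\<gamma> * r) * norm (\<phi> (\<epsilon> * r)) \<le> N"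
      using N[of "\<epsilon> * r"] that assms(2) by (simp add: mult_nonneg_nonpos)
    then show ?thesis by (simp add: exp_minus field_simps)
  qed
  then show "\<exists>N. \<forall>r\<le>0. norm (\<phi> (\<epsilon> * r)) \<le> N * exp (- \<gamma> * r)" by blast
qed

lemma C_fast_if_tame:
  assumes "tame \<psi>" "continuous_on {..0} \<psi>" "\<epsilon> > 0"
  shows "(\<lambda>t. if t \<le> 0 then \<psi> (t / \<epsilon>) else undefined) \<in> C_fast (- \<gamma> / \<epsilon>)"
proof -
  obtain N where N: "\<And>r. r \<le> 0 \<Longrightarrow> norm (\<psi> r) \<le> N * exp (- \<gamma> * r)"
    using assms(1) by (auto simp: tame_def)
  have "exp (\<gamma> * t / \<epsilon>) * norm (\<psi> (t / \<epsilon>)) \<le> N" if "t \<le> 0" for t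
  proof -
    have "norm (\<psi> (t / \<epsilon>)) \<le> N * exp (- \<gamma> * (t / \<epsilon>))"
      using that assms(3) by (intro N) (simp add: divide_nonpos_pos)
    then show ?thesis by (simp add: exp_minus field_simps)
  qed
  then have "bdd_above ((\<lambda>t. norm (exp (- (- \<gamma> / \<epsilon>) * t) *\<^sub>R (if t \<le> 0 then \<psi> (t / \<epsilon>) else undefined))) ` {..0})"
    by (intro bdd_aboveI2[where M = N]) auto
  moreover have "continuous_on {..0} (\<lambda>t. if t \<le> 0 then \<psi> (t / \<epsilon>) else undefined)"
  proof (rule continuous_on_eq)
    show "continuous_on {..0} (\<lambda>t. \<psi> (t / \<epsilon>))"
      by (rule continuous_on_compose2[OF assms(2)])
        (use assms(3) in \<open>auto intro!: continuous_intros simp: divide_nonpos_pos\<close>)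
  qed simp
  ultimately show ?thesis by (simp add: C_fast_def extensional_def)
qed

text \<open>Substitution s = \<epsilon> r: its Jacobian gives the factor \<epsilon>, and the
  reversed limits of integration give the sign.\<close>

lemma LBINT_eq_recent:
  assumes "t \<le> 0" "\<epsilon> > 0"
  shows "(LBINT s=0..t. U (t - s) (f s)) = - (\<epsilon> *\<^sub>R recent \<epsilon> (t / \<epsilon>) (\<lambda>r. f (\<epsilon> * r)))"
proof -
  have "(LBINT s=0..t. U (t - s) (f s)) = - (LINT s:{t<..<0}|lborel. U (t - s) (f s))"
    using assms(1) by (simp add: interval_lebesgue_integral_def zero_ereal_def set_lebesgue_integral_def)
  also have "(LINT s:{t<..<0}|lborel. U (t - s) (f s)) =
      \<epsilon> *\<^sub>R (\<integral>r. indicator {t<..<0} (\<epsilon> * r) *\<^sub>R U (t - \<epsilon> * r) (f (\<epsilon> * r)) \<partial>lborel)"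
    unfolding set_lebesgue_integral_def
    using lborel_integral_real_affine[of \<epsilon> "\<lambda>s. indicator {t<..<0} s *\<^sub>R U (t - s) (f s)" 0] assms(2) by simp
  also have "(\<lambda>r. indicator {t<..<0} (\<epsilon> * r) *\<^sub>R U (t - \<epsilon> * r) (f (\<epsilon> * r))) =
      (\<lambda>r. indicator {t / \<epsilon><..<0} r *\<^sub>R U (\<epsilon> * (t / \<epsilon> - r)) (f (\<epsilon> * r)))"
  proof
    fix r
    have "indicator {t<..<0} (\<epsilon> * r) = (indicator {t / \<epsilon><..<0} r :: real)"
      using assms(2) by (auto simp: indicator_def pos_divide_less_eq mult.commute mult_less_0_iff)
    moreover have "t - \<epsilon> * r = \<epsilon> * (t / \<epsilon> - r)"
      using assms(2) by (simp add: right_diff_distrib)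
    ultimately show "indicator {t<..<0} (\<epsilon> * r) *\<^sub>R U (t - \<epsilon> * r) (f (\<epsilon> * r)) =
        indicator {t / \<epsilon><..<0} r *\<^sub>R U (\<epsilon> * (t / \<epsilon> - r)) (f (\<epsilon> * r))" by simp
  qed
  finally show ?thesis by (simp add: recent_def set_lebesgue_integral_def)
qed

text \<open>The same substitution; here the Jacobian cancels the 1 / \<epsilon> of the fast
  equation.\<close>

lemma LBINT_eq_past:
  assumes "\<epsilon> > 0"
  shows "(1 / \<epsilon>) *\<^sub>R (LBINT s=-\<infinity>..t. V ((t - s) / \<epsilon>) (f s)) = past (t / \<epsilon>) (\<lambda>r. f (\<epsilon> * r))"
proof -
  have "(LBINT s=-\<infinity>..t. V ((t - s) / \<epsilon>) (f s)) = (LINT s:{..<t}|lborel. V ((t - s) / \<epsilon>) (f s))"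
    by (simp add: interval_lebesgue_integral_def)
  also have "\<dots> = \<epsilon> *\<^sub>R (\<integral>r. indicator {..<t} (\<epsilon> * r) *\<^sub>R V ((t - \<epsilon> * r) / \<epsilon>) (f (\<epsilon> * r)) \<partial>lborel)"
    unfolding set_lebesgue_integral_def
    using lborel_integral_real_affine[of \<epsilon> "\<lambda>s. indicator {..<t} s *\<^sub>R V ((t - s) / \<epsilon>) (f s)" 0] assms by simp
  also have "(\<lambda>r. indicator {..<t} (\<epsilon> * r) *\<^sub>R V ((t - \<epsilon> * r) / \<epsilon>) (f (\<epsilon> * r))) =
      (\<lambda>r. indicator {..<t / \<epsilon>} r *\<^sub>R V (t / \<epsilon> - r) (f (\<epsilon> * r)))"
  proof
    fix r
    have "indicator {..<t} (\<epsilon> * r) = (indicator {..<t / \<epsilon>} r :: real)"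
      using assms by (auto simp: indicator_def pos_less_divide_eq mult.commute)
    moreover have "(t - \<epsilon> * r) / \<epsilon> = t / \<epsilon> - r"
      using assms by (simp add: diff_divide_distrib)
    ultimately show "indicator {..<t} (\<epsilon> * r) *\<^sub>R V ((t - \<epsilon> * r) / \<epsilon>) (f (\<epsilon> * r)) =
        indicator {..<t / \<epsilon>} r *\<^sub>R V (t / \<epsilon> - r) (f (\<epsilon> * r))" by simp
  qed
  finally show ?thesis using assms by (simp add: past_def set_lebesgue_integral_def)
qed

lemma tame_Pair:
  assumes "tame f" "tame g"
  shows "tame (\<lambda>t. (f t :: 'a, g t :: 'b))"
proof -
  obtain N where N: "\<And>s. s \<le> 0 \<Longrightarrow> norm (f s) \<le> N * exp (- \<gamma> * s)"
    using assms(1) by (auto simp: tame_def)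
  obtain N' where N': "\<And>s. s \<le> 0 \<Longrightarrow> norm (g s) \<le> N' * exp (- \<gamma> * s)"
    using assms(2) by (auto simp: tame_def)
  have "norm (f s, g s) \<le> (N + N') * exp (- \<gamma> * s)" if "s \<le> 0" for s
    using norm_Pair_le[of "f s" "g s"] N[OF that] N'[OF that] by (simp add: algebra_simps)
  then show ?thesis
    unfolding tame_def using borel_measurable_Pair[OF tame_measurable[OF assms(1)] tame_measurable[OF assms(2)]]
    by blast
qed

lemma tame_fst_snd:
  assumes "tame (u :: real \<Rightarrow> 'a \<times> 'b)"
  shows "tame (\<lambda>t. fst (u t))" "tame (\<lambda>t. snd (u t))"
proof -
  obtain N where N: "\<And>s. s \<le> 0 \<Longrightarrow> norm (u s) \<le> N * exp (- \<gamma> * s)"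
    using assms by (auto simp: tame_def)
  have m: "(\<lambda>t. fst (u t)) \<in> borel_measurable borel" "(\<lambda>t. snd (u t)) \<in> borel_measurable borel"
    by (rule measurable_compose[OF tame_measurable_pair[OF assms]], measurable)+
  have "norm (fst (u s)) \<le> N * exp (- \<gamma> * s)" "norm (snd (u s)) \<le> N * exp (- \<gamma> * s)" if "s \<le> 0" for s
    using order_trans[OF norm_fst_le' N[OF that]] order_trans[OF norm_snd_le' N[OF that]] by auto
  then show "tame (\<lambda>t. fst (u t))" "tame (\<lambda>t. snd (u t))"
    unfolding tame_def using m by blast+
qed

lemma continuous_on_fixpoint:
  assumes "tame z" "small \<delta>"
  shows "continuous_on {..0} (fixpoint \<delta> z x0)"
  using continuous_on_integral_op[OF tame_fixpoint[OF assms] assms(1) small(1)[OF assms(2)]]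
    fixpoint_eq[OF assms] by metis

text \<open>An equivalence with an explicit pair contains existence and uniqueness together, which
  is what evaluates the definite description in \<open>slow_solution\<close>.\<close>

lemma slow_system_iff:
  assumes "tame z" "small \<epsilon>" "\<epsilon> > 0"
  shows "(x, y) \<in> C_pair (- \<gamma> / \<epsilon>) \<and>
      (\<forall>t\<le>0. x t = U t x0 + (LBINT s=0..t. U (t - s) (g1 (x s, y s + z (s / \<epsilon>)))) \<and>
             y t = (1 / \<epsilon>) *\<^sub>R (LBINT s=-\<infinity>..t. V ((t - s) / \<epsilon>) (g2 (x s, y s + z (s / \<epsilon>))))) \<longleftrightarrow>
    x = (\<lambda>t. if t \<le> 0 then fst (fixpoint \<epsilon> z x0 (t / \<epsilon>)) else undefined) \<and>
    y = (\<lambda>t. if t \<le> 0 then snd (fixpoint \<epsilon> z x0 (t / \<epsilon>)) else undefined)"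
    (is "_ \<and> ?eqs x y \<longleftrightarrow> x = ?x \<and> y = ?y")
proof -
  have eqs: "?eqs x y \<longleftrightarrow> (\<forall>r\<le>0. (x (\<epsilon> * r), y (\<epsilon> * r)) = integral_op \<epsilon> z x0 (\<lambda>r. (x (\<epsilon> * r), y (\<epsilon> * r))) r)"
    (is "_ \<longleftrightarrow> ?fix x y") for x y
  proof -
    have "?eqs x y \<longleftrightarrow> (\<forall>t\<le>0. (x t, y t) = integral_op \<epsilon> z x0 (\<lambda>r. (x (\<epsilon> * r), y (\<epsilon> * r))) (t / \<epsilon>))"
      using assms(3) LBINT_eq_recent[of _ \<epsilon> "\<lambda>s. g1 (x s, y s + z (s / \<epsilon>))"]
        LBINT_eq_past[OF assms(3), of _ "\<lambda>s. g2 (x s, y s + z (s / \<epsilon>))"]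
      by (simp add: integral_op_def divide_le_0_iff)
    also have "\<dots> \<longleftrightarrow> ?fix x y"
    proof (intro iffI allI impI)
      fix r :: real
      assume *: "\<forall>t\<le>0. (x t, y t) = integral_op \<epsilon> z x0 (\<lambda>r. (x (\<epsilon> * r), y (\<epsilon> * r))) (t / \<epsilon>)" and "r \<le> 0"
      then have "\<epsilon> * r \<le> 0" using assms(3) by (simp add: mult_nonneg_nonpos)
      from *[rule_format, OF this]
      show "(x (\<epsilon> * r), y (\<epsilon> * r)) = integral_op \<epsilon> z x0 (\<lambda>r. (x (\<epsilon> * r), y (\<epsilon> * r))) r"
        using assms(3) by simp
    next
      fix t :: real
      assume *: "?fix x y" and "t \<le> 0"
      then have "t / \<epsilon> \<le> 0" using assms(3) by (simp add: divide_nonpos_pos)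
      from *[rule_format, OF this]
      show "(x t, y t) = integral_op \<epsilon> z x0 (\<lambda>r. (x (\<epsilon> * r), y (\<epsilon> * r))) (t / \<epsilon>)"
        using assms(3) by simp
    qed
    finally show ?thesis .
  qed
  let ?u = "fixpoint \<epsilon> z x0"
  note tu = tame_fixpoint[OF assms(1,2), of x0] and cu = continuous_on_fixpoint[OF assms(1,2), of x0]
  show ?thesis
  proof
    assume "(x, y) \<in> C_pair (- \<gamma> / \<epsilon>) \<and> ?eqs x y"
    then have C: "x \<in> C_fast (- \<gamma> / \<epsilon>)" "y \<in> C_fast (- \<gamma> / \<epsilon>)" and fp: "?fix x y"
      unfolding eqs by (auto simp: C_pair_def)
    have tame: "tame (\<lambda>r. (x (\<epsilon> * r), y (\<epsilon> * r)))"
      by (intro tame_Pair tame_if_C_fast C assms(3))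
    have "(x t, y t) = ?u (t / \<epsilon>)" if "t \<le> 0" for t
      using fixpoint_unique[OF assms(1,2) tame fp[rule_format], of "t / \<epsilon>"] that assms(3)
      by (simp add: divide_nonpos_pos)
    then have "x t = ?x t" "y t = ?y t" for t
      using C by (auto simp: C_fast_def extensional_def prod_eq_iff)
    then show "x = ?x \<and> y = ?y" by blast
  next
    assume "x = ?x \<and> y = ?y"
    then have xy: "x = ?x" "y = ?y" by auto
    have "x \<in> C_fast (- \<gamma> / \<epsilon>)" "y \<in> C_fast (- \<gamma> / \<epsilon>)"
      unfolding xy by (rule C_fast_if_tame[OF _ _ assms(3)],
          intro tame_fst_snd tu, intro continuous_on_fst continuous_on_snd cu)+
    moreover have "?fix x y"
    proof (intro allI impI)
      fix r :: real assume "r \<le> 0"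
      have eq: "(x (\<epsilon> * r), y (\<epsilon> * r)) = ?u r" if "r \<le> 0" for r
        using that assms(3) by (simp add: xy mult_nonneg_nonpos)
      have "integral_op \<epsilon> z x0 (\<lambda>r. (x (\<epsilon> * r), y (\<epsilon> * r))) r = integral_op \<epsilon> z x0 ?u r"
        by (rule integral_op_cong) (use eq in auto)
      then show "(x (\<epsilon> * r), y (\<epsilon> * r)) = integral_op \<epsilon> z x0 (\<lambda>r. (x (\<epsilon> * r), y (\<epsilon> * r))) r"
        using eq[OF \<open>r \<le> 0\<close>] fixpoint_eq[OF assms(1,2), of x0] by simp
    qed
    ultimately show "(x, y) \<in> C_pair (- \<gamma> / \<epsilon>) \<and> ?eqs x y"
      unfolding eqs by (simp add: C_pair_def)
  qed
qed

text \<open>For \<delta> = 0 the slow component is frozen at x0, so a solution y of the critical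
  equation is the same as the solution (x0, y) of the full system.\<close>

lemma critical_equation_iff:
  assumes "tame z"
  shows "y \<in> C_fast (- \<gamma>) \<and> (\<forall>t\<le>0. y t = (LBINT s=-\<infinity>..t. V (t - s) (g2 (x0, y s + z s)))) \<longleftrightarrow>
    y = (\<lambda>t. if t \<le> 0 then snd (fixpoint 0 z x0 t) else undefined)"
    (is "_ \<and> ?eq y \<longleftrightarrow> y = ?y")
proof -
  have U0: "U 0 x0 = x0" using U_near[of 0 x0] by simp
  have eq: "?eq y \<longleftrightarrow> (\<forall>t\<le>0. (x0, y t) = integral_op 0 z x0 (\<lambda>t. (x0, y t)) t)" for y
    using LBINT_eq_past[of 1 _ "\<lambda>s. g2 (x0, y s + z s)"] by (simp add: integral_op_def U0)
  let ?u = "fixpoint 0 z x0"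
  note tu = tame_fixpoint[OF assms small_zero, of x0] and cu = continuous_on_fixpoint[OF assms small_zero, of x0]
  show ?thesis
  proof
    assume "y \<in> C_fast (- \<gamma>) \<and> ?eq y"
    then have C: "y \<in> C_fast (- \<gamma>)" and fp: "\<forall>t\<le>0. (x0, y t) = integral_op 0 z x0 (\<lambda>t. (x0, y t)) t"
      unfolding eq by auto
    have "tame y" using tame_if_C_fast[of y 1] C by simp
    then have tame: "tame (\<lambda>t. (x0, y t))" by (intro tame_Pair tame_const)
    have "(x0, y t) = ?u t" if "t \<le> 0" for t
      by (rule fixpoint_unique[OF assms small_zero tame fp[rule_format] that])
    then have "y t = ?y t" for t
      using C by (auto simp: C_fast_def extensional_def prod_eq_iff)
    then show "y = ?y" by blast
  next
    assume y: "y = ?y"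
    have "y \<in> C_fast (- \<gamma>)"
      using C_fast_if_tame[OF tame_fst_snd(2)[OF tu] continuous_on_snd[OF cu], of 1] by (simp add: y cong: if_cong)
    moreover have "\<forall>t\<le>0. (x0, y t) = integral_op 0 z x0 (\<lambda>t. (x0, y t)) t"
    proof (intro allI impI)
      fix t :: real assume "t \<le> 0"
      have eq: "(x0, y t) = ?u t" if "t \<le> 0" for t
        using that fst_fixpoint_zero[OF assms that, of x0] by (simp add: y prod_eq_iff)
      have "integral_op 0 z x0 (\<lambda>t. (x0, y t)) t = integral_op 0 z x0 ?u t"
        by (rule integral_op_cong) (use eq in auto)
      then show "(x0, y t) = integral_op 0 z x0 (\<lambda>t. (x0, y t)) t"
        using eq[OF \<open>t \<le> 0\<close>] fixpoint_eq[OF assms small_zero, of x0] by simp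
    qed
    ultimately show "y \<in> C_fast (- \<gamma>) \<and> ?eq y" unfolding eq by simp
  qed
qed

end

subsection \<open>Noise paths\<close>

text \<open>The value and the left limit at x bound the path on a neighbourhood of x; bisection then
  glues these local bounds.\<close>

lemma cadlag_imp_bounded:
  fixes f :: "real \<Rightarrow> 'a::real_normed_vector"
  assumes "cadlag f" "a \<le> b"
  shows "\<exists>B. \<forall>y\<in>{a..b}. norm (f y) \<le> B"
  using \<open>a \<le> b\<close>
proof (induction rule: Bolzano)
  case (trans a b c)
  then obtain B B' where "\<forall>y\<in>{a..b}. norm (f y) \<le> B" "\<forall>y\<in>{b..c}. norm (f y) \<le> B'" by blast
  then have "\<forall>y\<in>{a..c}. norm (f y) \<le> max B B'"
    by (metis atLeastAtMost_iff le_max_iff_disj linear)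
  then show ?case by blast
next
  case (local x)
  from assms(1) obtain l where r: "(f \<longlongrightarrow> f x) (at_right x)" and l: "(f \<longlongrightarrow> l) (at_left x)"
    by (auto simp: cadlag_def continuous_within)
  from r have "\<forall>\<^sub>F y in at_right x. dist (f y) (f x) < 1" by (rule tendstoD) simp
  then obtain u where u: "u > x" "\<And>y. x < y \<Longrightarrow> y < u \<Longrightarrow> dist (f y) (f x) < 1"
    by (auto simp: eventually_at_right_field)
  from l have "\<forall>\<^sub>F y in at_left x. dist (f y) l < 1" by (rule tendstoD) simp
  then obtain v where v: "v < x" "\<And>y. v < y \<Longrightarrow> y < x \<Longrightarrow> dist (f y) l < 1"
    by (auto simp: eventually_at_left_field)
  let ?B = "norm (f x) + norm l + 1"
  have B: "norm (f y) \<le> ?B" if "v < y" "y < u" for y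
  proof -
    consider "y < x" | "y = x" | "y > x" by linarith
    then show ?thesis
    proof cases
      case 1
      have "norm (f y) \<le> norm (f y - l) + norm l" using norm_triangle_sub[of "f y" l] by simp
      then show ?thesis using v(2)[OF that(1) 1] norm_ge_zero[of "f x"] unfolding dist_norm by linarith
    next
      case 2 then show ?thesis by simp
    next
      case 3
      have "norm (f y) \<le> norm (f y - f x) + norm (f x)" using norm_triangle_sub[of "f y" "f x"] by simp
      then show ?thesis using u(2)[OF 3 that(2)] norm_ge_zero[of l] unfolding dist_norm by linarith
    qed
  qed
  have "\<exists>B. \<forall>y\<in>{a..b}. norm (f y) \<le> B" if "a \<le> x" "x \<le> b" "b - a < min (u - x) (x - v)" for a b
    using B that by (intro exI[of _ ?B]) auto
  then show ?case using u(1) v(1) by (intro exI[of _ "min (u - x) (x - v)"]) auto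
qed

lemma cadlag_sublinear_exp_bound:
  fixes f :: "real \<Rightarrow> 'a::real_normed_vector"
  assumes "cadlag f" "sublinear f" "\<gamma> > 0"
  shows "\<exists>N. \<forall>s\<le>0. norm (f s) \<le> N * exp (- \<gamma> * s)"
proof -
  have "\<forall>\<^sub>F t in at_infinity. norm (f t) / \<bar>t\<bar> < 1"
    using assms(2) unfolding sublinear_def by (rule order_tendstoD) simp
  then obtain R where R: "\<And>t. \<bar>t\<bar> \<ge> R \<Longrightarrow> norm (f t) / \<bar>t\<bar> < 1"
    by (auto simp: eventually_at_infinity)
  \<comment> \<open>At least 1, so that s is nonzero outside the compact interval and the quotient
    by |s| can be cleared.\<close>
  define R' where "R' = max R 1"
  obtain B where B: "\<And>y. - R' \<le> y \<Longrightarrow> y \<le> 0 \<Longrightarrow> norm (f y) \<le> B"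
    using cadlag_imp_bounded[OF assms(1), of "- R'" 0] by (force simp: R'_def)
  define N where "N = max B (1 / \<gamma>)"
  have "norm (f s) \<le> N * exp (- \<gamma> * s)" if s: "s \<le> 0" for s
  proof (cases "- R' \<le> s")
    case True
    have "N \<ge> 0" using \<open>\<gamma> > 0\<close> by (simp add: N_def le_max_iff_disj)
    have "norm (f s) \<le> N * 1" using B[OF True s] by (simp add: N_def)
    also have "\<dots> \<le> N * exp (- \<gamma> * s)"
      using s \<open>\<gamma> > 0\<close> \<open>N \<ge> 0\<close> by (intro mult_left_mono) (auto simp: mult_nonneg_nonpos)
    finally show ?thesis .
  next
    case False
    then have "norm (f s) / \<bar>s\<bar> < 1" "s < 0" using R[of s] by (auto simp: R'_def)
    then have "norm (f s) \<le> 1 / \<gamma> * (- \<gamma> * s)" using \<open>\<gamma> > 0\<close> by (simp add: field_simps)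
    also have "\<dots> \<le> N * exp (- \<gamma> * s)"
      using exp_ge_add_one_self[of "- \<gamma> * s"] s \<open>\<gamma> > 0\<close>
      by (intro mult_mono) (auto simp: N_def mult_nonneg_nonpos le_max_iff_disj)
    finally show ?thesis .
  qed
  then show ?thesis by blast
qed

text \<open>Time is replaced by grid points approaching it from the right. Each approximation takes
  countably many times, which makes it jointly measurable, and right continuity identifies the
  limit.\<close>

lemma right_continuous_joint_measurable:
  fixes f :: "real \<Rightarrow> 'w \<Rightarrow> 'a::real_normed_vector"
  assumes meas: "\<And>s. f s \<in> borel_measurable M"
    and cont: "\<And>s w. w \<in> space M \<Longrightarrow> continuous (at_right s) (\<lambda>s. f s w)"
  shows "(\<lambda>(s, w). f s w) \<in> borel_measurable (borel \<Otimes>\<^sub>M M)"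
proof (rule borel_measurable_LIMSEQ_metric)
  define a :: "nat \<Rightarrow> real \<Rightarrow> real"
    \<comment> \<open>Adding 1 to the floor makes the grid point strictly larger than s, as a limit
      from the right requires.\<close>
    where "a n s = (of_int \<lfloor>s * real (Suc n)\<rfloor> + 1) / real (Suc n)" for n s
  show "(\<lambda>(s, w). f (a n s) w) \<in> borel_measurable (borel \<Otimes>\<^sub>M M)" for n
  proof -
    have "(\<lambda>x. f ((of_int \<lfloor>fst x * real (Suc n)\<rfloor> + 1) / real (Suc n)) (snd x))
        \<in> borel_measurable (borel \<Otimes>\<^sub>M M)"
      by (rule measurable_compose_countable[where f = "\<lambda>i x. f ((of_int i + 1) / real (Suc n)) (snd x)"])
        (use meas in measurable)
    then show ?thesis by (simp add: a_def split_beta)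
  qed
  fix x :: "real \<times> 'w" assume "x \<in> space (borel \<Otimes>\<^sub>M M)"
  then obtain s w where x: "x = (s, w)" "w \<in> space M" by (auto simp: space_pair_measure)
  have gt: "s < a n s" for n
    unfolding a_def by (subst pos_less_divide_eq, simp, linarith)
  have le: "a n s \<le> s + 1 / real (Suc n)" for n
  proof -
    have "a n s \<le> (s * real (Suc n) + 1) / real (Suc n)"
      unfolding a_def by (intro divide_right_mono add_right_mono) auto
    then show ?thesis by (simp add: add_divide_distrib del: of_nat_Suc)
  qed
  have "(\<lambda>n. s + 1 / real (Suc n)) \<longlonglongrightarrow> s + 0"
    by (intro tendsto_add tendsto_const lim_1_over_n[THEN LIMSEQ_Suc])
  then have lim: "(\<lambda>n. s + 1 / real (Suc n)) \<longlonglongrightarrow> s" by (simp only: add_0_right)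
  have "(\<lambda>n. a n s) \<longlonglongrightarrow> s"
  proof (rule tendsto_sandwich[OF _ _ tendsto_const lim])
    show "\<forall>\<^sub>F n in sequentially. s \<le> a n s"
      by (rule always_eventually, rule allI, rule less_imp_le, rule gt)
    show "\<forall>\<^sub>F n in sequentially. a n s \<le> s + 1 / real (Suc n)"
      by (rule always_eventually, rule allI, rule le)
  qed
  then have "filterlim (\<lambda>n. a n s) (at_right s) sequentially"
    using gt by (simp add: filterlim_at less_imp_neq[THEN not_sym])
  from filterlim_compose[OF cont[OF x(2), of s, unfolded continuous_within] this]
  show "(\<lambda>n. (\<lambda>(s, w). f (a n s) w) x) \<longlonglongrightarrow> (\<lambda>(s, w). f s w) x"
    by (simp add: x)
qed

lemma filterlim_mult_at_right:
  fixes c :: real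
  assumes "c > 0"
  shows "filterlim (\<lambda>t. c * t) (at_right (c * t)) (at_right t)"
  unfolding filterlim_at
proof
  show "\<forall>\<^sub>F x in at_right t. c * x \<in> {c * t<..} \<and> c * x \<noteq> c * t"
    using eventually_at_right_less[of t] by eventually_elim (use assms in auto)
  show "((*) c \<longlongrightarrow> c * t) (at_right t)" by (intro tendsto_intros)
qed

lemma filterlim_mult_at_left:
  fixes c :: real
  assumes "c > 0"
  shows "filterlim (\<lambda>t. c * t) (at_left (c * t)) (at_left t)"
  unfolding filterlim_at
proof
  have "\<forall>\<^sub>F x in at_left t. x < t" by (simp add: eventually_at_filter)
  then show "\<forall>\<^sub>F x in at_left t. c * x \<in> {..<c * t} \<and> c * x \<noteq> c * t"
    by eventually_elim (use assms in auto)
  show "((*) c \<longlongrightarrow> c * t) (at_left t)" by (intro tendsto_intros)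
qed

lemma cadlag_time_scale:
  assumes "cadlag f" "c > 0"
  shows "cadlag (\<lambda>t. f (c * t))"
  unfolding cadlag_def
proof (intro allI conjI)
  fix t :: real
  have "(f \<longlongrightarrow> f (c * t)) (at_right (c * t))"
    using assms(1) by (simp add: cadlag_def continuous_within)
  from filterlim_compose[OF this filterlim_mult_at_right[OF assms(2)]]
  show "continuous (at_right t) (\<lambda>t. f (c * t))" by (simp add: continuous_within)
  obtain l where "(f \<longlongrightarrow> l) (at_left (c * t))"
    using assms(1) by (auto simp: cadlag_def)
  from filterlim_compose[OF this filterlim_mult_at_left[OF assms(2)]]
  show "\<exists>l. ((\<lambda>t. f (c * t)) \<longlongrightarrow> l) (at_left t)" by blast
qed

lemma sublinear_time_scale:
  assumes "sublinear f" "c > 0"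
  shows "sublinear (\<lambda>t. f (c * t))"
proof -
  have "filterlim (\<lambda>t::real. c * t) at_infinity at_infinity"
    by (rule tendsto_mult_filterlim_at_infinity[OF tendsto_const]) (use assms(2) in \<open>auto intro: filterlim_ident\<close>)
  from filterlim_compose[OF assms(1)[unfolded sublinear_def] this]
  have "((\<lambda>t. c * (norm (f (c * t)) / \<bar>c * t\<bar>)) \<longlongrightarrow> c * 0) at_infinity" by (intro tendsto_intros)
  then show ?thesis using assms(2) by (simp add: sublinear_def abs_mult)
qed

section \<open>Pathwise Riemann-Stieltjes integrals: scaling and measurability\<close>

lemma tagged_division_scale:
  fixes c :: real
  assumes p: "p tagged_division_of {a..b}" and c: "c > 0"
  shows "(\<lambda>(x, k). (c * x, (*) c ` k)) ` p tagged_division_of {c * a..c * b}"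
proof (rule tagged_division_ofI)
  note D = tagged_division_ofD[OF p]
  have box: "(*) c ` cbox u v = cbox (c * u) (c * v)" for u v
    using c by (simp add: image_mult_atLeastAtMost_if' cbox_interval)
  show "finite ((\<lambda>(x, k). (c * x, (*) c ` k)) ` p)" using D(1) by simp
  fix x K assume "(x, K) \<in> (\<lambda>(x, k). (c * x, (*) c ` k)) ` p"
  then obtain y J where yJ: "(y, J) \<in> p" "x = c * y" "K = (*) c ` J" by auto
  show "x \<in> K" unfolding yJ by (rule imageI[OF D(2)[OF yJ(1)]])
  have "(*) c ` J \<subseteq> (*) c ` {a..b}" by (rule image_mono[OF D(3)[OF yJ(1)]])
  then show "K \<subseteq> {c * a..c * b}" using yJ(3) box[of a b] by (simp add: cbox_interval)
  show "\<exists>a b. K = cbox a b" using D(4)[OF yJ(1)] yJ(3) box by metis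
  fix x' K' assume "(x', K') \<in> (\<lambda>(x, k). (c * x, (*) c ` k)) ` p" and ne: "(x, K) \<noteq> (x', K')"
  then obtain y' J' where yJ': "(y', J') \<in> p" "x' = c * y'" "K' = (*) c ` J'" by auto
  have disj: "interior J \<inter> interior J' = {}" using D(5)[OF yJ(1) yJ'(1)] ne yJ yJ' by auto
  have "interior ((*) c ` J) = (*) c ` interior J" for J :: "real set"
    by (rule interior_injective_linear_image) (use c in \<open>auto simp: inj_on_def intro: linearI simp: algebra_simps\<close>)
  then show "interior K \<inter> interior K' = {}" using disj c unfolding yJ yJ' by auto
next
  note D = tagged_division_ofD[OF p]
  have "\<Union>{K. \<exists>x. (x, K) \<in> (\<lambda>(x, k). (c * x, (*) c ` k)) ` p} = (*) c ` \<Union>{K. \<exists>x. (x, K) \<in> p}"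
  proof (intro equalityI subsetI)
    fix y assume "y \<in> \<Union>{K. \<exists>x. (x, K) \<in> (\<lambda>(x, k). (c * x, (*) c ` k)) ` p}"
    then show "y \<in> (*) c ` \<Union>{K. \<exists>x. (x, K) \<in> p}" by auto
  next
    fix y assume "y \<in> (*) c ` \<Union>{K. \<exists>x. (x, K) \<in> p}"
    then obtain x K where "(x, K) \<in> p" "y \<in> (*) c ` K" by auto
    moreover from this have "(c * x, (*) c ` K) \<in> (\<lambda>(x, k). (c * x, (*) c ` k)) ` p" by force
    ultimately show "y \<in> \<Union>{K. \<exists>x. (x, K) \<in> (\<lambda>(x, k). (c * x, (*) c ` k)) ` p}" by blast
  qed
  also have "\<dots> = {c * a..c * b}"
    using c D(6) by (simp add: image_mult_atLeastAtMost_if')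
  finally show "\<Union>{K. \<exists>x. (x, K) \<in> (\<lambda>(x, k). (c * x, (*) c ` k)) ` p} = {c * a..c * b}" .
qed

definition RS_sum ::
    "(real \<Rightarrow> real^'n^'m) \<Rightarrow> (real \<Rightarrow> real^'n) \<Rightarrow> (real \<times> real set) set \<Rightarrow> real^'m" where
  "RS_sum f L p = (\<Sum>(x, k)\<in>p. f x *v (L (Sup k) - L (Inf k)))"

lemma RS_sum_scale:
  fixes c :: real
  assumes p: "p tagged_division_of {a..b}" and c: "c > 0"
  shows "RS_sum f L ((\<lambda>(x, k). (c * x, (*) c ` k)) ` p) = RS_sum (\<lambda>s. f (c * s)) (\<lambda>s. L (c * s)) p"
proof -
  have inj: "inj ((*) c)" using c by (simp add: inj_on_def)
  have "inj_on (\<lambda>(x, k). (c * x, (*) c ` k)) p"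
    using c by (auto simp: inj_on_def inj_image_eq_iff[OF inj])
  moreover have "Sup ((*) c ` k) = c * Sup k \<and> Inf ((*) c ` k) = c * Inf k" if xk: "(x, k) \<in> p" for x k
  proof -
    obtain u v where "k = {u..v}" "u \<le> v"
      using tagged_division_ofD(2,4)[OF p xk] by (auto simp: cbox_interval)
    then show ?thesis using c by (simp add: image_mult_atLeastAtMost_if')
  qed
  ultimately show ?thesis
    unfolding RS_sum_def by (subst sum.reindex) (auto intro!: sum.cong)
qed

lemma has_RS_integral_scale:
  assumes "has_RS_integral f L (c * a) (c * b) I" "c > 0"
  shows "has_RS_integral (\<lambda>s. f (c * s)) (\<lambda>s. k *\<^sub>R L (c * s)) a b (k *\<^sub>R I)"
  unfolding has_RS_integral_def
proof (intro allI impI)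
  fix e :: real assume e: "e > 0"
  \<comment> \<open>The added 1 covers k = 0 as well.\<close>
  define e' where "e' = e / (\<bar>k\<bar> + 1)"
  have "e' > 0" using e by (simp add: e'_def)
  with assms(1) obtain d where "d > 0" and d:
    "\<And>p. p tagged_division_of {c * a..c * b} \<Longrightarrow> (\<lambda>x. ball x d) fine p \<Longrightarrow> norm (RS_sum f L p - I) < e'"
    unfolding has_RS_integral_def RS_sum_def by meson
  have "norm (RS_sum (\<lambda>s. f (c * s)) (\<lambda>s. k *\<^sub>R L (c * s)) p - k *\<^sub>R I) < e"
    if p: "p tagged_division_of {a..b}" and fine: "(\<lambda>x. ball x (d / c)) fine p" for p
  proof -
    let ?q = "(\<lambda>(x, k). (c * x, (*) c ` k)) ` p"
    have "(\<lambda>x. ball x d) fine ?q"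
      unfolding fine_def
    proof clarsimp
      fix x K y assume "(x, K) \<in> p" "y \<in> K"
      then have "dist x y < d / c" using fine unfolding fine_def by fastforce
      then show "dist (c * x) (c * y) < d"
        using \<open>c > 0\<close> by (simp add: dist_real_def abs_mult pos_less_divide_eq mult.commute flip: right_diff_distrib)
    qed
    from d[OF tagged_division_scale[OF p \<open>c > 0\<close>] this]
    have lt: "norm (RS_sum (\<lambda>s. f (c * s)) (\<lambda>s. L (c * s)) p - I) < e'"
      by (simp add: RS_sum_scale[OF p \<open>c > 0\<close>])
    have "RS_sum (\<lambda>s. f (c * s)) (\<lambda>s. k *\<^sub>R L (c * s)) p = k *\<^sub>R RS_sum (\<lambda>s. f (c * s)) (\<lambda>s. L (c * s)) p"
      unfolding RS_sum_def scaleR_sum_right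
      by (intro sum.cong) (auto simp: matrix_vector_mult_scaleR simp flip: scaleR_diff_right)
    then have "norm (RS_sum (\<lambda>s. f (c * s)) (\<lambda>s. k *\<^sub>R L (c * s)) p - k *\<^sub>R I)
        = \<bar>k\<bar> * norm (RS_sum (\<lambda>s. f (c * s)) (\<lambda>s. L (c * s)) p - I)"
      by (simp flip: scaleR_diff_right)
    also have "\<dots> \<le> \<bar>k\<bar> * e'" using lt by (intro mult_left_mono) auto
    also have "\<dots> < e" using e by (simp add: e'_def field_simps)
    finally show ?thesis .
  qed
  then show "\<exists>d>0. \<forall>p. p tagged_division_of {a..b} \<and> (\<lambda>x. ball x d) fine p \<longrightarrow>
      norm ((\<Sum>(x, K)\<in>p. f (c * x) *v (k *\<^sub>R L (c * Sup K) - k *\<^sub>R L (c * Inf K))) - k *\<^sub>R I) < e"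
    using \<open>d > 0\<close> \<open>c > 0\<close> unfolding RS_sum_def by (intro exI[of _ "d / c"]) auto
qed

lemma has_past_integral_scale:
  assumes "has_past_integral f L I" "c > 0"
  shows "has_past_integral (\<lambda>s. f (c * s)) (\<lambda>s. k *\<^sub>R L (c * s)) (k *\<^sub>R I)"
proof -
  obtain J where J: "\<And>T. T \<ge> 0 \<Longrightarrow> has_RS_integral f L (- T) 0 (J T)" "(J \<longlongrightarrow> I) at_top"
    using assms(1) unfolding has_past_integral_def by blast
  have "has_RS_integral (\<lambda>s. f (c * s)) (\<lambda>s. k *\<^sub>R L (c * s)) (- T) 0 (k *\<^sub>R J (c * T))" if "T \<ge> 0" for T
    by (rule has_RS_integral_scale) (use J(1)[of "c * T"] that assms(2) in auto)
  moreover have "filterlim (\<lambda>T. c * T) at_top at_top"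
    by (rule filterlim_tendsto_pos_mult_at_top[OF tendsto_const assms(2) filterlim_ident])
  then have "((\<lambda>T. k *\<^sub>R J (c * T)) \<longlongrightarrow> k *\<^sub>R I) at_top"
    by (intro tendsto_scaleR tendsto_const filterlim_compose[OF J(2)])
  ultimately show ?thesis unfolding has_past_integral_def by (intro exI[of _ "\<lambda>T. k *\<^sub>R J (c * T)"]) blast
qed

text \<open>One sequence of partitions chosen independently of integrand and path. Along it the
  integral is a limit of fixed finite combinations of evaluations, hence measurable in the
  path.\<close>

definition fine_partition :: "nat \<Rightarrow> nat \<Rightarrow> (real \<times> real set) set" where
  "fine_partition T m = (SOME p. p tagged_division_of {- real T..0} \<and> (\<lambda>x. ball x (1 / real (Suc m))) fine p)"

lemma fine_partition:
  "fine_partition T m tagged_division_of {- real T..0}"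
  "(\<lambda>x. ball x (1 / real (Suc m))) fine fine_partition T m"
proof -
  have "gauge (\<lambda>x::real. ball x (1 / real (Suc m)))" by (intro gauge_ball) simp
  from fine_division_exists_real[OF this, of "- real T" 0]
  have "\<exists>p. p tagged_division_of {- real T..0} \<and> (\<lambda>x. ball x (1 / real (Suc m))) fine p" by metis
  from someI_ex[OF this] show "fine_partition T m tagged_division_of {- real T..0}"
    "(\<lambda>x. ball x (1 / real (Suc m))) fine fine_partition T m"
    unfolding fine_partition_def by auto
qed

lemma RS_sum_tendsto:
  assumes "has_RS_integral f L (- real T) 0 I"
  shows "(\<lambda>m. RS_sum f L (fine_partition T m)) \<longlonglongrightarrow> I"
proof (rule metric_LIMSEQ_I)
  fix e :: real assume "e > 0"
  with assms obtain d where "d > 0" and d: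
    "\<And>p. p tagged_division_of {- real T..0} \<Longrightarrow> (\<lambda>x. ball x d) fine p \<Longrightarrow> norm (RS_sum f L p - I) < e"
    unfolding has_RS_integral_def RS_sum_def by meson
  obtain n where n: "1 / real (Suc n) < d" using \<open>d > 0\<close> nat_approx_posE by blast
  have "dist (RS_sum f L (fine_partition T m)) I < e" if "m \<ge> n" for m
  proof -
    have "1 / real (Suc m) \<le> 1 / real (Suc n)" using that by (intro divide_left_mono) auto
    then have "ball x (1 / real (Suc m)) \<subseteq> ball x d" for x :: real
      using n by (intro subset_ball) linarith
    then have "(\<lambda>x. ball x d) fine fine_partition T m"
      using fine_partition(2)[of m T] unfolding fine_def by blast
    then show ?thesis using d fine_partition(1) by (simp add: dist_norm)
  qed
  then show "\<exists>n. \<forall>m\<ge>n. dist (RS_sum f L (fine_partition T m)) I < e" by blast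
qed

text \<open>The integral as an explicit iterated limit. This yields its uniqueness and, through
  finite sums, its measurability.\<close>

lemma has_past_integral_limit:
  assumes "has_past_integral f L I"
  shows "lim (\<lambda>T. lim (\<lambda>m. RS_sum f L (fine_partition T m))) = I"
proof -
  obtain J where J: "\<And>T. T \<ge> 0 \<Longrightarrow> has_RS_integral f L (- T) 0 (J T)" "(J \<longlongrightarrow> I) at_top"
    using assms unfolding has_past_integral_def by blast
  have "lim (\<lambda>m. RS_sum f L (fine_partition T m)) = J (real T)" for T
    by (intro limI RS_sum_tendsto J) simp
  moreover have "(\<lambda>T. J (real T)) \<longlonglongrightarrow> I"
    by (rule filterlim_compose[OF J(2) filterlim_real_sequentially])
  ultimately show ?thesis by (simp add: limI)
qed

lemma past_integral_eq:
  assumes "has_past_integral f L I"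
  shows "past_integral f L = I"
  unfolding past_integral_def using assms has_past_integral_limit by blast

lemma measurable_past_integral:
  fixes g :: "'w \<Rightarrow> real \<Rightarrow> real^'n" and f :: "real \<Rightarrow> real^'n^'m"
  assumes meas: "\<And>t. (\<lambda>w. g w t) \<in> borel_measurable M"
    and ex: "\<And>w. w \<in> space M \<Longrightarrow> \<exists>I. has_past_integral f (g w) I"
  shows "(\<lambda>w. past_integral f (g w)) \<in> borel_measurable M"
proof -
  have mv: "(\<lambda>x. A *v x) \<in> borel_measurable borel" for A :: "real^'n^'m"
    by (intro borel_measurable_continuous_onI linear_continuous_on matrix_vector_mul_bounded_linear)
  have "(\<lambda>w. RS_sum f (g w) p) \<in> borel_measurable M" for p
    unfolding RS_sum_def split_beta
    by (intro borel_measurable_sum measurable_compose[OF _ mv] borel_measurable_diff meas)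
  then have "(\<lambda>w. lim (\<lambda>T. lim (\<lambda>m. RS_sum f (g w) (fine_partition T m)))) \<in> borel_measurable M"
    by (intro borel_measurable_lim_metric)
  then show ?thesis
    by (rule measurable_cong[THEN iffD1, rotated]) (use ex has_past_integral_limit past_integral_eq in metis)
qed

text \<open>A common state space for the paths in \<open>\<Omega>\<close> and their rescalings,
  which need not lie in \<open>\<Omega>\<close>. Integrals are demanded for all shifts so that
  \<open>xi\<close> is given by the iterated limit at every time.\<close>

definition noise_paths :: "real^'n^'n \<Rightarrow> (real \<Rightarrow> real^'n) set" where
  "noise_paths F = {w. (\<forall>t. \<exists>I. has_past_integral (\<lambda>s. matrix_exp ((- s) *\<^sub>R F)) (shift t w) I) \<and>
     cadlag (\<lambda>t. xi F (shift t w)) \<and> sublinear (\<lambda>t. xi F (shift t w))}"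

text \<open>The set \<^const>\<open>noise_paths\<close> need not be measurable for the product \<open>\<sigma>\<close>-algebra, but its trace
  suffices: self-similarity only speaks about the law on the product space, and all solutions turn
  out to be measurable with respect to evaluations. The Skorokhod topology is thus not needed.\<close>

definition path_space :: "real^'n^'n \<Rightarrow> (real \<Rightarrow> real^'n) measure" where
  "path_space F = restrict_space (Pi\<^sub>M UNIV (\<lambda>_. borel)) (noise_paths F)"

lemma space_path_space: "space (path_space F) = noise_paths F"
  by (simp add: path_space_def space_restrict_space space_PiM)

lemma measurable_xi_shift:
  "(\<lambda>(t, w). xi F (shift t w)) \<in> borel_measurable (borel \<Otimes>\<^sub>M path_space F)"
proof (rule right_continuous_joint_measurable)
  fix t
  have ev: "(\<lambda>w. w s) \<in> borel_measurable (path_space F)" for s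
    unfolding path_space_def by (intro measurable_restrict_space1 measurable_component_singleton) simp
  show "(\<lambda>w. xi F (shift t w)) \<in> borel_measurable (path_space F)"
    unfolding xi_def
  proof (rule measurable_past_integral)
    show "(\<lambda>w. shift t w s) \<in> borel_measurable (path_space F)" for s
      unfolding shift_def by (intro borel_measurable_diff ev)
  qed (auto simp: space_path_space noise_paths_def)
qed (auto simp: space_path_space noise_paths_def cadlag_def)

section \<open>Rescaled paths and their law\<close>

definition rescale :: "real \<Rightarrow> real \<Rightarrow> (real \<Rightarrow> 'a::real_normed_vector) \<Rightarrow> real \<Rightarrow> 'a" where
  "rescale \<alpha> \<epsilon> w = (\<lambda>t. (\<epsilon> powr (- 1 / \<alpha>)) *\<^sub>R w (\<epsilon> * t))"

lemma shift_rescale: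
  "shift t (rescale \<alpha> \<epsilon> w) = (\<lambda>s. (\<epsilon> powr (- 1 / \<alpha>)) *\<^sub>R shift (\<epsilon> * t) w (\<epsilon> * s))"
  by (simp add: shift_def rescale_def fun_eq_iff scaleR_diff_right distrib_left)

text \<open>Time scaling turns the kernel e^(-Fs/\<epsilon>) into e^(-Fs), and the prefactor of
  \<open>eta\<close> moves into the path. Existence and path regularity for the rescaled path are
  thus inherited from \<open>eta\<close> at speed \<epsilon>.\<close>

lemma
  assumes "good_noise_set P F \<alpha> \<Omega>" "w \<in> \<Omega>" "\<epsilon> > 0"
  shows eta_shift_eq_xi: "eta F \<alpha> \<epsilon> (shift (\<epsilon> * t) w) = xi F (shift t (rescale \<alpha> \<epsilon> w))"
    and rescale_in_noise_paths: "rescale \<alpha> \<epsilon> w \<in> noise_paths F"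
proof -
  have ex: "\<exists>I. has_past_integral (\<lambda>s. matrix_exp ((- s) *\<^sub>R F)) (shift t (rescale \<alpha> \<epsilon> w)) I \<and>
      eta F \<alpha> \<epsilon> (shift (\<epsilon> * t) w) = I" for t
  proof -
    have "shift (\<epsilon> * t) w \<in> \<Omega>" using assms by (simp add: good_noise_set_def)
    then obtain I where I: "has_past_integral (\<lambda>s. matrix_exp ((- s / \<epsilon>) *\<^sub>R F)) (shift (\<epsilon> * t) w) I"
      using assms unfolding good_noise_set_def by meson
    have "eta F \<alpha> \<epsilon> (shift (\<epsilon> * t) w) = \<epsilon> powr (- 1 / \<alpha>) *\<^sub>R I"
      unfolding eta_def past_integral_eq[OF I] ..
    with has_past_integral_scale[OF I \<open>\<epsilon> > 0\<close>, of "\<epsilon> powr (- 1 / \<alpha>)"] show ?thesis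
      using \<open>\<epsilon> > 0\<close> by (simp add: shift_rescale)
  qed
  then have eq: "eta F \<alpha> \<epsilon> (shift (\<epsilon> * t) w) = xi F (shift t (rescale \<alpha> \<epsilon> w))" for t
    unfolding xi_def using past_integral_eq by metis
  then show "eta F \<alpha> \<epsilon> (shift (\<epsilon> * t) w) = xi F (shift t (rescale \<alpha> \<epsilon> w))" .
  have "cadlag (\<lambda>t. eta F \<alpha> \<epsilon> (shift t w))" "sublinear (\<lambda>t. eta F \<alpha> \<epsilon> (shift t w))"
    using assms by (auto simp: good_noise_set_def)
  then have "cadlag (\<lambda>t. xi F (shift t (rescale \<alpha> \<epsilon> w)))" "sublinear (\<lambda>t. xi F (shift t (rescale \<alpha> \<epsilon> w)))"
    unfolding eq[symmetric] using cadlag_time_scale sublinear_time_scale \<open>\<epsilon> > 0\<close> by blast+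
  then show "rescale \<alpha> \<epsilon> w \<in> noise_paths F"
    unfolding noise_paths_def using ex by blast
qed

lemma good_noise_subset: "good_noise_set P F \<alpha> \<Omega> \<Longrightarrow> \<Omega> \<subseteq> noise_paths F"
  unfolding good_noise_set_def noise_paths_def by blast

text \<open>Self-similarity with c = 1, where both processes are the path itself; equality in
  distribution includes measurability.\<close>

lemma evaluation_measurable:
  assumes "self_similar \<alpha> P"
  shows "(\<lambda>w. w) \<in> P \<rightarrow>\<^sub>M Pi\<^sub>M UNIV (\<lambda>_. borel)"
  using assms[unfolded self_similar_def eq_in_distr_def, rule_format, of 1] by simp

lemma scaleR_path_measurable:
  "(\<lambda>w t. c *\<^sub>R w t) \<in> Pi\<^sub>M UNIV (\<lambda>_. borel :: 'a::euclidean_space measure) \<rightarrow>\<^sub>M Pi\<^sub>M UNIV (\<lambda>_. borel)"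
  by (rule measurable_PiM_single') (auto simp: space_PiM intro!: borel_measurable_scaleR measurable_component_singleton)

text \<open>Both sides of the self-similarity relation are pushed forward by division by
  \<open>\<epsilon> powr (1 / \<alpha>)\<close>, which leaves the unscaled path on the
  right.\<close>

lemma rescale_law:
  fixes P :: "(real \<Rightarrow> 'a::euclidean_space) measure"
  assumes "self_similar \<alpha> P" "\<epsilon> > 0"
  shows "rescale \<alpha> \<epsilon> \<in> P \<rightarrow>\<^sub>M Pi\<^sub>M UNIV (\<lambda>_. borel)"
    and "distr P (Pi\<^sub>M UNIV (\<lambda>_. borel)) (rescale \<alpha> \<epsilon>) = distr P (Pi\<^sub>M UNIV (\<lambda>_. borel)) (\<lambda>w. w)"
proof -
  let ?B = "Pi\<^sub>M UNIV (\<lambda>_. borel) :: (real \<Rightarrow> 'a) measure"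
  let ?c = "\<epsilon> powr (- 1 / \<alpha>)"
  have sim: "(\<lambda>w t. w (\<epsilon> * t)) \<in> P \<rightarrow>\<^sub>M ?B" "(\<lambda>w t. (\<epsilon> powr (1 / \<alpha>)) *\<^sub>R w t) \<in> P \<rightarrow>\<^sub>M ?B"
    "distr P ?B (\<lambda>w t. w (\<epsilon> * t)) = distr P ?B (\<lambda>w t. (\<epsilon> powr (1 / \<alpha>)) *\<^sub>R w t)"
    using assms unfolding self_similar_def eq_in_distr_def by auto
  have comp: "rescale \<alpha> \<epsilon> = (\<lambda>w t. ?c *\<^sub>R w t) \<circ> (\<lambda>w t. w (\<epsilon> * t))"
    by (simp add: rescale_def fun_eq_iff)
  have id: "(\<lambda>w t. ?c *\<^sub>R w t) \<circ> (\<lambda>w t. (\<epsilon> powr (1 / \<alpha>)) *\<^sub>R w t) = (\<lambda>w :: real \<Rightarrow> 'a. w)"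
    using \<open>\<epsilon> > 0\<close> by (simp add: fun_eq_iff powr_add[symmetric])
  show "rescale \<alpha> \<epsilon> \<in> P \<rightarrow>\<^sub>M ?B"
    unfolding comp by (rule measurable_comp[OF sim(1) scaleR_path_measurable])
  show "distr P ?B (rescale \<alpha> \<epsilon>) = distr P ?B (\<lambda>w. w)"
    unfolding comp distr_distr[OF scaleR_path_measurable sim(1), symmetric] sim(3)
      distr_distr[OF scaleR_path_measurable sim(2)] id ..
qed

lemma path_law:
  fixes P :: "(real \<Rightarrow> real^'n) measure"
  assumes "prob_space P" "self_similar \<alpha> P" and \<Omega>: "good_noise_set P F \<alpha> \<Omega>" and "\<epsilon> > 0"
  shows "(\<lambda>w. w) \<in> restrict_space P \<Omega> \<rightarrow>\<^sub>M path_space F"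
    and "rescale \<alpha> \<epsilon> \<in> restrict_space P \<Omega> \<rightarrow>\<^sub>M path_space F"
    and "distr (restrict_space P \<Omega>) (path_space F) (rescale \<alpha> \<epsilon>) =
         distr (restrict_space P \<Omega>) (path_space F) (\<lambda>w. w)"
proof -
  interpret prob_space P by fact
  let ?B = "Pi\<^sub>M UNIV (\<lambda>_. borel) :: (real \<Rightarrow> real^'n) measure"
  let ?N = "restrict_space P \<Omega>"
  have \<Omega>P: "\<Omega> \<in> sets P" "prob \<Omega> = 1" using \<Omega> by (auto simp: good_noise_set_def)
  have sp: "space ?N = \<Omega>" using sets.sets_into_space[OF \<Omega>P(1)] by (auto simp: space_restrict_space)
  have AE: "AE w in P. w \<in> \<Omega>" using \<Omega>P by (simp add: AE_in_set_eq_1)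
  \<comment> \<open>Measurable sets of \<open>path_space F\<close> are traces of product sets
    \<open>A\<close>. As \<open>f\<close> maps \<open>\<Omega>\<close> into
    \<open>noise_paths F\<close> and \<open>\<Omega>\<close> has full measure, the trace has the
    probability of \<open>A\<close> itself.\<close>
  have em: "emeasure (distr ?N (path_space F) f) (noise_paths F \<inter> A) = emeasure (distr P ?B f) A"
    if f: "f \<in> P \<rightarrow>\<^sub>M ?B" "f \<in> ?N \<rightarrow>\<^sub>M path_space F" and A: "A \<in> sets ?B" for f A
  proof -
    have sA: "noise_paths F \<inter> A \<in> sets (path_space F)"
      using A by (auto simp: path_space_def sets_restrict_space)
    have maps: "f w \<in> noise_paths F" if "w \<in> \<Omega>" for w
      using measurable_space[OF f(2)] that by (simp add: sp space_path_space)
    have "emeasure (distr ?N (path_space F) f) (noise_paths F \<inter> A) = emeasure ?N (f -` A \<inter> \<Omega>)"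
      using maps by (subst emeasure_distr[OF f(2) sA]) (auto simp: sp intro!: arg_cong[of _ _ "emeasure ?N"])
    also have "\<dots> = emeasure P (f -` A \<inter> \<Omega>)"
      by (subst emeasure_restrict_space) (use \<Omega>P in auto)
    also have "\<dots> = emeasure P (f -` A \<inter> space P)"
    proof (rule emeasure_eq_AE)
      show m: "f -` A \<inter> space P \<in> events" by (rule measurable_sets[OF f(1) A])
      have "f -` A \<inter> \<Omega> = (f -` A \<inter> space P) \<inter> \<Omega>" using sets.sets_into_space[OF \<Omega>P(1)] by auto
      then show "f -` A \<inter> \<Omega> \<in> events" using m \<Omega>P(1) by simp
      show "AE x in P. (x \<in> f -` A \<inter> \<Omega>) = (x \<in> f -` A \<inter> space P)"
        using AE AE_space by eventually_elim auto
    qed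
    finally show ?thesis by (simp add: emeasure_distr[OF f(1) A])
  qed
  show idm: "(\<lambda>w. w) \<in> ?N \<rightarrow>\<^sub>M path_space F"
    unfolding path_space_def
    by (intro measurable_restrict_space2 measurable_restrict_space1 evaluation_measurable[OF assms(2)])
      (use good_noise_subset[OF \<Omega>] in \<open>auto simp: sp\<close>)
  show rm: "rescale \<alpha> \<epsilon> \<in> ?N \<rightarrow>\<^sub>M path_space F"
    unfolding path_space_def
    by (intro measurable_restrict_space2 measurable_restrict_space1 rescale_law(1)[OF assms(2,4)])
      (use rescale_in_noise_paths[OF \<Omega> _ assms(4)] in \<open>auto simp: sp\<close>)
  show "distr ?N (path_space F) (rescale \<alpha> \<epsilon>) = distr ?N (path_space F) (\<lambda>w. w)"
  proof (rule measure_eqI)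
    fix X assume "X \<in> sets (distr ?N (path_space F) (rescale \<alpha> \<epsilon>))"
    then obtain A where A: "A \<in> sets ?B" "X = noise_paths F \<inter> A"
      by (auto simp: path_space_def sets_restrict_space)
    show "emeasure (distr ?N (path_space F) (rescale \<alpha> \<epsilon>)) X = emeasure (distr ?N (path_space F) (\<lambda>w. w)) X"
      unfolding A(2) em[OF rescale_law(1)[OF assms(2,4)] rm A(1)]
        em[OF evaluation_measurable[OF assms(2)] idm A(1)] rescale_law(2)[OF assms(2,4)] ..
  qed simp
qed

subsection \<open>Convergence of the slow manifold\<close>

theorem theorem5:
  fixes S :: "real^'n1^'n1" and F :: "real^'n2^'n2"
    and g1 :: "(real^'n1) \<times> (real^'n2) \<Rightarrow> real^'n1"
    and g2 :: "(real^'n1) \<times> (real^'n2) \<Rightarrow> real^'n2"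
    and \<sigma> \<alpha> \<gamma>\<^sub>s \<gamma>\<^sub>f K \<gamma> :: real
    and P :: "(real \<Rightarrow> real^'n2) measure" and \<Omega> :: "(real \<Rightarrow> real^'n2) set"
  assumes "\<sigma> > 0" and "1 < \<alpha>" and "\<alpha> < 2"
    and "\<And>z. complex_eigenvalue S z \<Longrightarrow> Re z \<ge> 0"
    and "\<And>z. complex_eigenvalue F z \<Longrightarrow> Re z < 0"
    and "\<exists>C. C-lipschitz_on UNIV g1" and "\<exists>C. C-lipschitz_on UNIV g2"
    and "g1 (0, 0) = 0" and "g2 (0, 0) = 0"
    and A1: "\<gamma>\<^sub>s > 0" "\<gamma>\<^sub>f < 0"
      "\<And>t x. t \<le> 0 \<Longrightarrow> norm (matrix_exp (t *\<^sub>R S) *v x) \<le> exp (\<gamma>\<^sub>s * t) * norm x"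
      "\<And>t y. t \<ge> 0 \<Longrightarrow> norm (matrix_exp (t *\<^sub>R F) *v y) \<le> exp (\<gamma>\<^sub>f * t) * norm y"
    and A2: "K > 0"
      "\<And>x1 y1 x2 y2. norm (g1 (x1, y1) - g1 (x2, y2)) \<le> K * (norm (x1 - x2) + norm (y1 - y2))"
      "\<And>x1 y1 x2 y2. norm (g2 (x1, y1) - g2 (x2, y2)) \<le> K * (norm (x1 - x2) + norm (y1 - y2))"
    and A3: "K < - \<gamma>\<^sub>f"
    and "\<gamma> > 0" and "K < - (\<gamma> + \<gamma>\<^sub>f)"
    and noise: "two_sided_stable_levy \<alpha> P" "good_noise_set P F \<alpha> \<Omega>"
    and bounded: "\<exists>C>0. \<forall>x y. norm (g1 (x, y)) \<le> C"
  shows "manifold_converges_in_distr (restrict_space P \<Omega>)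
           (\<lambda>\<epsilon>. graph_of (h_slow S F g1 g2 \<sigma> \<alpha> \<gamma> \<epsilon>))
           (graph_of (h_critical F g2 \<sigma> \<gamma>))"
proof -
  obtain C where C: "\<And>x y. norm (g1 (x, y)) \<le> C" using bounded by blast
  have contr: "norm (matrix_exp (t *\<^sub>R S) *v x) \<le> norm x" if "t \<le> 0" for t x
  proof -
    have "exp (\<gamma>\<^sub>s * t) * norm x \<le> 1 * norm x"
      using that A1(1) by (intro mult_right_mono) (auto simp: mult_nonneg_nonpos)
    then show ?thesis using A1(3)[OF that, of x] by simp
  qed
  obtain D where D: "D \<ge> 0"
    "\<And>t x. t \<le> 0 \<Longrightarrow> norm (matrix_exp (t *\<^sub>R S) *v x - x) \<le> D * \<bar>t\<bar> * norm x"
    using matrix_exp_contraction_near_id[of S] contr by metis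
  interpret slow_fast "\<lambda>t x. matrix_exp (t *\<^sub>R S) *v x" "\<lambda>t y. matrix_exp (t *\<^sub>R F) *v y" g1 g2 \<gamma> "\<gamma>\<^sub>f" K C D
  proof (rule slow_fast.intro)
    show "norm (g1 p) \<le> C" for p using C[of "fst p" "snd p"] by simp
  qed (rule matrix_exp_flow_continuous matrix_vector_mul_linear contr D A1(4) A2 assms(8,9)
      \<open>\<gamma> > 0\<close> \<open>K < - (\<gamma> + \<gamma>\<^sub>f)\<close> | assumption)+
  have P: "prob_space P" "self_similar \<alpha> P"
    using noise(1) by (auto simp: two_sided_stable_levy_def two_sided_levy_def)
  let ?N = "restrict_space P \<Omega>"
  have sp: "space ?N = \<Omega>"
    using noise(2) sets.sets_into_space[of \<Omega> P] by (auto simp: good_noise_set_def space_restrict_space)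
  define z where "z w s = \<sigma> *\<^sub>R xi F (shift s w)" for w s
  have z_meas: "(\<lambda>(s, w). z w s) \<in> borel_measurable (borel \<Otimes>\<^sub>M path_space F)"
    using borel_measurable_scaleR[OF borel_measurable_const[of \<sigma>] measurable_xi_shift[of F]]
    by (simp add: z_def split_beta)
  have z_tame: "tame (z w)" if w: "w \<in> noise_paths F" for w
    unfolding tame_def
  proof
    have "(\<lambda>s. (s, w)) \<in> borel \<rightarrow>\<^sub>M borel \<Otimes>\<^sub>M path_space F"
      by (rule measurable_Pair2') (simp add: space_path_space w)
    from measurable_compose[OF this z_meas] show "z w \<in> borel_measurable borel" by simp
    obtain N where N: "\<And>s. s \<le> 0 \<Longrightarrow> norm (xi F (shift s w)) \<le> N * exp (- \<gamma> * s)"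
      using cadlag_sublinear_exp_bound[of "\<lambda>s. xi F (shift s w)" \<gamma>] w \<open>\<gamma> > 0\<close>
      by (auto simp: noise_paths_def)
    then have "norm (z w s) \<le> (\<sigma> * N) * exp (- \<gamma> * s)" if "s \<le> 0" for s
      using mult_left_mono[OF N[OF that], of \<sigma>] \<open>\<sigma> > 0\<close> by (simp add: z_def)
    then show "\<exists>N. \<forall>s\<le>0. norm (z w s) \<le> N * exp (- \<gamma> * s)" by blast
  qed
  \<comment> \<open>The value at time 0 as a functional of the path driving \<open>xi\<close>;
    \<epsilon> = 0 gives the critical manifold.\<close>
  define h where "h \<epsilon> x0 w = snd (fixpoint \<epsilon> (z w) x0 0)" for \<epsilon> x0 w
  have snd_meas: "(snd :: (real^'n1) \<times> (real^'n2) \<Rightarrow> real^'n2) \<in> borel_measurable borel"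
    by (intro borel_measurable_continuous_onI continuous_intros)
  have h_meas: "h \<epsilon> x0 \<in> borel_measurable (path_space F)" if "small \<epsilon>" for \<epsilon> x0
    using measurable_compose[OF measurable_fixpoint[OF z_meas _ that, of x0 0] snd_meas] z_tame
    by (simp add: h_def[abs_def] space_path_space)
  have slow: "h_slow S F g1 g2 \<sigma> \<alpha> \<gamma> \<epsilon> w x0 = h \<epsilon> x0 (rescale \<alpha> \<epsilon> w)"
    if "w \<in> \<Omega>" "small \<epsilon>" "\<epsilon> > 0" for \<epsilon> w x0
  proof -
    have eta: "\<sigma> *\<^sub>R eta F \<alpha> \<epsilon> (shift s w) = z (rescale \<alpha> \<epsilon> w) (s / \<epsilon>)" for s
      using eta_shift_eq_xi[OF noise(2) that(1,3), of "s / \<epsilon>"] that(3) by (simp add: z_def)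
    have "slow_solution S F g1 g2 \<sigma> \<alpha> \<gamma> \<epsilon> w x0 =
        (\<lambda>t. if t \<le> 0 then fst (fixpoint \<epsilon> (z (rescale \<alpha> \<epsilon> w)) x0 (t / \<epsilon>)) else undefined,
         \<lambda>t. if t \<le> 0 then snd (fixpoint \<epsilon> (z (rescale \<alpha> \<epsilon> w)) x0 (t / \<epsilon>)) else undefined)"
      unfolding slow_solution_def eta
        slow_system_iff[OF z_tame[OF rescale_in_noise_paths[OF noise(2) that(1,3)]] that(2,3)]
      by (rule the_equality) auto
    then show ?thesis by (simp add: h_slow_def h_def)
  qed
  have critical: "h_critical F g2 \<sigma> \<gamma> w x0 = h 0 x0 w" if "w \<in> noise_paths F" for w x0
  proof -
    note iff = critical_equation_iff[OF z_tame[OF that], of _ x0]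
    have eq: "critical_solution F g2 \<sigma> \<gamma> w x0 =
        (\<lambda>t. if t \<le> 0 then snd (fixpoint 0 (z w) x0 t) else undefined)" (is "_ = ?y")
      unfolding critical_solution_def z_def[symmetric] iff by (rule the_equality) auto
    \<comment> \<open>The critical equation at t = 0 is the integral that defines
      \<open>h_critical\<close>.\<close>
    from iff[THEN iffD2, OF refl, THEN conjunct2, rule_format, OF order_refl]
    show ?thesis
      by (simp only: h_critical_def eq z_def[symmetric] h_def zero_ereal_def diff_0 order_refl if_True)
  qed
  have sub: "\<Omega> \<subseteq> noise_paths F" by (rule good_noise_subset[OF noise(2)])
  show ?thesis
    unfolding manifold_converges_in_distr_def
  proof (intro exI conjI allI)
    fix x0
    \<comment> \<open>Both functionals are taken at \<open>w\<close>, not at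
      \<open>rescale \<alpha> \<epsilon> w\<close>, which is what makes the remainder pathwise of
      order \<epsilon>.\<close>
    define r where "r \<epsilon> w = h \<epsilon> x0 w - h 0 x0 w" for \<epsilon> w
    have "\<forall>\<^sub>F \<epsilon> in at_right 0. small \<epsilon> \<and> \<epsilon> > 0"
      using eventually_small eventually_at_right_less[of "0::real"] by eventually_elim simp
    then show "\<forall>\<^sub>F \<epsilon> in at_right 0. r \<epsilon> \<in> borel_measurable ?N \<and>
        eq_in_distr ?N borel (\<lambda>w. h_slow S F g1 g2 \<sigma> \<alpha> \<gamma> \<epsilon> w x0) (\<lambda>w. h_critical F g2 \<sigma> \<gamma> w x0 + r \<epsilon> w)"
    proof eventually_elim
      case (elim \<epsilon>)
      then have \<epsilon>: "small \<epsilon>" "\<epsilon> > 0" by auto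
      note law = path_law[OF P noise(2) \<epsilon>(2)]
      have m: "h \<epsilon> x0 \<in> borel_measurable ?N" "h 0 x0 \<in> borel_measurable ?N"
        "(\<lambda>w. h \<epsilon> x0 (rescale \<alpha> \<epsilon> w)) \<in> borel_measurable ?N"
        using measurable_compose[OF law(1) h_meas] measurable_compose[OF law(2) h_meas] \<epsilon>(1) small_zero
        by auto
      have s: "h_slow S F g1 g2 \<sigma> \<alpha> \<gamma> \<epsilon> w x0 = h \<epsilon> x0 (rescale \<alpha> \<epsilon> w)" if "w \<in> space ?N" for w
        using slow that \<epsilon> by (simp add: sp)
      have c: "h_critical F g2 \<sigma> \<gamma> w x0 + r \<epsilon> w = h \<epsilon> x0 w" if "w \<in> space ?N" for w
        using critical sub that by (auto simp: sp r_def)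
      have "distr ?N borel (\<lambda>w. h_slow S F g1 g2 \<sigma> \<alpha> \<gamma> \<epsilon> w x0) = distr ?N borel (h \<epsilon> x0 \<circ> rescale \<alpha> \<epsilon>)"
        by (intro distr_cong) (simp_all add: s)
      also have "\<dots> = distr (distr ?N (path_space F) (rescale \<alpha> \<epsilon>)) borel (h \<epsilon> x0)"
        by (rule distr_distr[symmetric, OF h_meas[OF \<epsilon>(1)] law(2)])
      also have "\<dots> = distr ?N borel (h \<epsilon> x0 \<circ> (\<lambda>w. w))"
        unfolding law(3) by (rule distr_distr[OF h_meas[OF \<epsilon>(1)] law(1)])
      also have "\<dots> = distr ?N borel (\<lambda>w. h_critical F g2 \<sigma> \<gamma> w x0 + r \<epsilon> w)"
        by (intro distr_cong) (simp_all add: c)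
      finally have "distr ?N borel (\<lambda>w. h_slow S F g1 g2 \<sigma> \<alpha> \<gamma> \<epsilon> w x0) =
        distr ?N borel (\<lambda>w. h_critical F g2 \<sigma> \<gamma> w x0 + r \<epsilon> w)" .
      moreover have "r \<epsilon> \<in> borel_measurable ?N"
        unfolding r_def[abs_def] by (intro borel_measurable_diff m)
      moreover have "(\<lambda>w. h_slow S F g1 g2 \<sigma> \<alpha> \<gamma> \<epsilon> w x0) \<in> borel_measurable ?N"
        using m(3) by (rule measurable_cong[THEN iffD2, rotated]) (rule s)
      moreover have "(\<lambda>w. h_critical F g2 \<sigma> \<gamma> w x0 + r \<epsilon> w) \<in> borel_measurable ?N"
        using m(1) by (rule measurable_cong[THEN iffD2, rotated]) (rule c)
      ultimately show ?case unfolding eq_in_distr_def by blast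
    qed
    show "\<forall>w\<in>space ?N. (\<lambda>\<epsilon>. norm (r \<epsilon> w)) \<in> O[at_right 0](\<lambda>\<epsilon>. \<epsilon>)"
    proof
      fix w assume "w \<in> space ?N"
      then have w: "tame (z w)" using z_tame sub by (auto simp: sp)
      let ?c = "(K / \<kappa>) * ((D * norm x0 + C) / \<gamma>) / (1 - K / \<kappa>)"
      have "\<forall>\<^sub>F \<epsilon> in at_right 0. norm (norm (r \<epsilon> w)) \<le> ?c * norm \<epsilon>"
        using eventually_small
      proof eventually_elim
        case (elim \<epsilon>)
        from fixpoint_near_critical[OF w elim, of x0] show ?case
          using small(1)[OF elim] by (simp add: r_def h_def)
      qed
      then show "(\<lambda>\<epsilon>. norm (r \<epsilon> w)) \<in> O[at_right 0](\<lambda>\<epsilon>. \<epsilon>)" by (rule bigoI)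
    qed
  qed (rule refl)+
qed

end
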